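(* Let $k\ge 1$ be an integer and let $G$ be an $(X,Y,a,b)$-graph with $a\ge 2k$ and $b\ge 2k$. Let $\lambda_2$ be the second largest eigenvalue of the adjacency matrix of $G$. If $$\lambda_2\le \sqrt{ab} -\frac{k}{\sqrt{\left\lceil\frac{a+1}{2}\right\rceil\left\lceil\frac{b+1}{2}\right\rceil}},$$ then $\tau(G)\geq k$.
   Context: All graphs are finite and simple. An $(X,Y,a,b)$-graph is a bipartite graph with bipartition $(X,Y)$ ($X,Y$ nonempty, $a,b$ positive integers) in which every vertex of $X$ has degree $a$ and every vertex of $Y$ has degree $b$ (so $a|X|=b|Y|$); it is not assumed connected. The eigenvalues of the adjacency matrix of $G$ on $n$ vertices are ordered $\lambda_1\ge\lambda_2\ge\cdots\ge\lambda_n$, counted with multiplicity. The spanning tree packing number $\tau(G)$ is the maximum number of pairwise edge-disjoint spanning trees contained in $G$. *)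

theory Defs
  imports "Jordan_Normal_Form.Char_Poly"
begin

text \<open>
  A finite simple graph is given by its vertex set \<open>V\<close> and its edge set \<open>E\<close>, edges being
  two-element sets of vertices. The notion of spanning tree in \<open>Graph_Theory\<close> is not used: it is
  one for digraphs, where acyclicity only excludes directed cycles, so that it does not yield
  spanning trees of undirected graphs.
\<close>

definition simple_graph :: "'a set \<Rightarrow> 'a set set \<Rightarrow> bool" where
  "simple_graph V E \<longleftrightarrow> finite V \<and> (\<forall>e\<in>E. e \<subseteq> V \<and> card e = 2)"

definition degree_in :: "'a set set \<Rightarrow> 'a \<Rightarrow> nat" where
  "degree_in E v = card {e \<in> E. v \<in> e}"

definition biregular_graph ::
    "'a set \<Rightarrow> 'a set set \<Rightarrow> 'a set \<Rightarrow> 'a set \<Rightarrow> nat \<Rightarrow> nat \<Rightarrow> bool" where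
  "biregular_graph V E X Y a b \<longleftrightarrow>
     simple_graph V E \<and>
     X \<noteq> {} \<and> Y \<noteq> {} \<and> X \<inter> Y = {} \<and> X \<union> Y = V \<and>
     (\<forall>e\<in>E. \<exists>x\<in>X. \<exists>y\<in>Y. e = {x, y}) \<and>
     a > 0 \<and> b > 0 \<and>
     (\<forall>x\<in>X. degree_in E x = a) \<and> (\<forall>y\<in>Y. degree_in E y = b)"

definition graph_connected :: "'a set \<Rightarrow> 'a set set \<Rightarrow> bool" where
  "graph_connected V E \<longleftrightarrow> (\<forall>u\<in>V. \<forall>v\<in>V. (u, v) \<in> {(x, y). {x, y} \<in> E}\<^sup>*)"

text \<open>The list of the vertices of a cycle, each listed once; the last is joined to the first.\<close>

definition is_graph_cycle :: "'a set set \<Rightarrow> 'a list \<Rightarrow> bool" where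
  "is_graph_cycle E vs \<longleftrightarrow>
     length vs \<ge> 3 \<and> distinct vs \<and>
     (\<forall>i < length vs. {vs ! i, vs ! (Suc i mod length vs)} \<in> E)"

definition is_tree :: "'a set \<Rightarrow> 'a set set \<Rightarrow> bool" where
  "is_tree V T \<longleftrightarrow> simple_graph V T \<and> graph_connected V T \<and> (\<nexists>vs. is_graph_cycle T vs)"

text \<open>A spanning tree has all of \<open>V\<close> as vertices, so it is determined by its edge set.\<close>

definition spanning_trees :: "'a set \<Rightarrow> 'a set set \<Rightarrow> 'a set set set" where
  "spanning_trees V E = {T. T \<subseteq> E \<and> is_tree V T}"

text \<open>
  The maximum is over a nonempty set (take \<open>F = {}\<close>), which is finite for finite \<open>V\<close>, as \<open>F\<close> is
  then a subset of the finite set \<open>Pow E\<close>. Distinct members of \<open>F\<close> are edge-disjoint.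
\<close>

definition spanning_tree_packing_number :: "'a set \<Rightarrow> 'a set set \<Rightarrow> nat" where
  "spanning_tree_packing_number V E =
     Max {card F |F. F \<subseteq> spanning_trees V E \<and> pairwise disjnt F}"

text \<open>
  The rows and columns of the adjacency matrix are indexed by an arbitrary enumeration of the
  vertices; its choice changes the matrix only by a simultaneous permutation of rows and columns,
  and hence does not affect the eigenvalues.
\<close>

definition vertex_list :: "'a set \<Rightarrow> 'a list" where
  "vertex_list V = (SOME vs. distinct vs \<and> set vs = V)"

definition adjacency_matrix :: "'a set \<Rightarrow> 'a set set \<Rightarrow> real mat" where
  "adjacency_matrix V E =
     mat (card V) (card V)
       (\<lambda>(i, j). if {vertex_list V ! i, vertex_list V ! j} \<in> E then 1 else 0)"

text \<open>
  The eigenvalues in decreasing order with (algebraic) multiplicity. The adjacency matrix of a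
  simple graph is real symmetric, so its characteristic polynomial has \<open>card V\<close> real roots and
  algebraic and geometric multiplicities agree.
\<close>

definition graph_eigenvalues :: "'a set \<Rightarrow> 'a set set \<Rightarrow> real list" where
  "graph_eigenvalues V E =
     rev (sorted_list_of_multiset (proots (char_poly (adjacency_matrix V E))))"

text \<open>\<open>graph_eigenvalue V E i\<close> is the \<open>i\<close>-th largest eigenvalue for \<open>1 \<le> i \<le> card V\<close>.\<close>

definition graph_eigenvalue :: "'a set \<Rightarrow> 'a set set \<Rightarrow> nat \<Rightarrow> real" where
  "graph_eigenvalue V E i = graph_eigenvalues V E ! (i - 1)"

end

theory Submission
  imports Defs "HOL-Analysis.Function_Topology"
begin

text \<open>
  By the tree packing theorem of Nash-Williams and Tutte, it suffices that every partition of the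
  vertex set into \<open>t\<close> classes is crossed by at least \<open>k (t - 1)\<close> edges. If each class \<open>C\<close> has at least
  \<open>2 k (1 - vol C / vol V)\<close> edges leaving it, where \<open>vol\<close> is any measure on the vertices, then summing
  over the classes counts each crossing edge twice and gives the required bound, because the
  fractions \<open>vol C / vol V\<close> add up to 1.
  
  The measure to take is the sum of the degrees, which comes from the top eigenfunction
  \<open>u v = sqrt (deg v)\<close> of a biregular graph, with eigenvalue \<open>sqrt (a b)\<close>. If \<open>\<theta> < sqrt (a b)\<close> is an
  upper bound for the second eigenvalue, then the quadratic form of the adjacency matrix is at most
  \<open>\<theta>\<close> times the squared norm on the orthogonal complement of \<open>u\<close>
  (\<open>quadratic_form_le_second_eigenvalue\<close>). Evaluated at \<open>u\<close> times the centred indicator function of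
  \<open>C\<close>, this bounds the number of edges leaving \<open>C\<close> from below
  (\<open>spectral_cut_bound\<close>). A class left by at least \<open>2 k\<close> edges needs no further argument. A class
  left by fewer edges has more than \<open>b / 2\<close> vertices in \<open>X\<close> and more than \<open>a / 2\<close> in \<open>Y\<close>, that is, at
  least \<open>\<lceil>(b + 1) / 2\<rceil>\<close> and \<open>\<lceil>(a + 1) / 2\<rceil>\<close>; its volume is then so large that the assumed
  spectral gap yields the estimate (\<open>boundary_ge_of_second_eigenvalue\<close>).
  
  The bound on the quadratic form is proved without diagonalising the matrix. A maximiser of the form
  on the unit sphere of the orthogonal complement exists by compactness and is an eigenfunction. If
  the maximum exceeded \<open>\<theta>\<close>, there would be two orthogonal eigenfunctions with eigenvalues above
  \<open>\<theta>\<close>, and these account for two roots of the characteristic polynomial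
  (\<open>char_poly_dvd_two_eigenvectors\<close>).
  
  The tree packing theorem (\<open>nash_williams_tutte\<close>) is proved by an exchange argument on a
  packing of \<open>k\<close> forests with as many edges as possible.
\<close>

section \<open>Linked vertices and forests\<close>

definition linked :: "'a set set \<Rightarrow> ('a \<times> 'a) set" where
  "linked S = {(x, y). {x, y} \<in> S}\<^sup>*"

lemma linked_refl [simp]: "(v, v) \<in> linked S"
  by (simp add: linked_def)

lemma linked_edge: "{x, y} \<in> S \<Longrightarrow> (x, y) \<in> linked S"
  by (auto simp: linked_def)

lemma linked_sym: "(x, y) \<in> linked S \<Longrightarrow> (y, x) \<in> linked S"
proof -
  have "sym {(x, y). {x, y} \<in> S}" by (auto simp: sym_def insert_commute)
  then show "(x, y) \<in> linked S \<Longrightarrow> (y, x) \<in> linked S"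
    unfolding linked_def by (blast dest: symD[OF sym_rtrancl])
qed

lemma linked_trans: "(x, y) \<in> linked S \<Longrightarrow> (y, z) \<in> linked S \<Longrightarrow> (x, z) \<in> linked S"
  unfolding linked_def by (rule rtrancl_trans)

lemma linked_least:
  assumes "\<And>x y. {x, y} \<in> S \<Longrightarrow> (x, y) \<in> linked T"
  shows "linked S \<subseteq> linked T"
proof (clarify)
  fix x y assume "(x, y) \<in> linked S"
  then have "(x, y) \<in> {(x, y). {x, y} \<in> S}\<^sup>*" by (simp add: linked_def)
  then show "(x, y) \<in> linked T"
    by (induction rule: rtrancl_induct) (auto intro: linked_trans assms)
qed

lemma linked_mono: "S \<subseteq> T \<Longrightarrow> linked S \<subseteq> linked T"
  by (rule linked_least) (auto intro: linked_edge)

text \<open>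
  A walk through the new edge can be cut at its first and last use of that edge.
\<close>

lemma linked_insertE:
  assumes "(u, v) \<in> linked (insert {x, y} S)"
  shows "(u, v) \<in> linked S \<or> ((u, x) \<in> linked S \<and> (y, v) \<in> linked S)
           \<or> ((u, y) \<in> linked S \<and> (x, v) \<in> linked S)"
proof -
  have "(u, v) \<in> {(p, q). {p, q} \<in> insert {x, y} S}\<^sup>*"
    using assms by (simp add: linked_def)
  then show ?thesis
  proof (induction rule: rtrancl_induct)
    case base
    then show ?case by simp
  next
    case (step v w)
    from step.hyps(2) consider "{v, w} \<in> S" | "v = x" "w = y" | "v = y" "w = x"
      by (auto simp: doubleton_eq_iff)
    then show ?case
    proof cases
      case 1
      then have "(v, w) \<in> linked S" by (rule linked_edge)
      then show ?thesis using step.IH linked_trans by metis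
    next
      case 2
      then show ?thesis using step.IH by auto
    next
      case 3
      then show ?thesis using step.IH by auto
    qed
  qed
qed

text \<open>
  A graph is a forest when every edge is a bridge. Unlike the absence of a cyclic list of vertices,
  this form can be handled by reasoning on the relation \<open>linked\<close> alone.
\<close>

definition forest :: "'a set set \<Rightarrow> bool" where
  "forest S \<longleftrightarrow> (\<forall>x y. {x, y} \<in> S \<longrightarrow> (x, y) \<notin> linked (S - {{x, y}}))"

lemma forestD: "forest S \<Longrightarrow> {x, y} \<in> S \<Longrightarrow> (x, y) \<notin> linked (S - {{x, y}})"
  by (simp add: forest_def)

lemma forest_subset: "forest S \<Longrightarrow> T \<subseteq> S \<Longrightarrow> forest T"
  unfolding forest_def using linked_mono[OF Diff_mono[OF _ order_refl]] by blast

text \<open>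
  If an old edge \<open>{p, q}\<close> stopped being a bridge, a detour would pass through the new edge, and its
  two halves together with \<open>{p, q}\<close> would already join \<open>x\<close> to \<open>y\<close>.
\<close>

lemma forest_insert:
  assumes "forest S" and xy: "(x, y) \<notin> linked S"
  shows "forest (insert {x, y} S)"
  unfolding forest_def
proof (intro allI impI notI)
  fix p q
  assume pq: "{p, q} \<in> insert {x, y} S"
    and l: "(p, q) \<in> linked (insert {x, y} S - {{p, q}})"
  have xyS: "{x, y} \<notin> S" using xy linked_edge[of x y S] by blast
  show False
  proof (cases "{p, q} = {x, y}")
    case True
    then have "(p, q) \<in> linked S" using l xyS by simp
    then show False using True xy linked_sym[of y x S] by (auto simp: doubleton_eq_iff)
  next
    case False
    define R where "R = S - {{p, q}}"
    have pqS: "{p, q} \<in> S" and "insert {x, y} S - {{p, q}} = insert {x, y} R"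
      using pq False by (auto simp: R_def)
    then have l': "(p, q) \<in> linked (insert {x, y} R)" using l by simp
    have RS: "linked R \<subseteq> linked S" by (rule linked_mono) (auto simp: R_def)
    have n: "(p, q) \<notin> linked R" using forestD[OF assms(1) pqS] by (simp add: R_def)
    have pq': "(p, q) \<in> linked S" using pqS by (rule linked_edge)
    from linked_insertE[OF l'] n
    consider "(p, x) \<in> linked R" "(y, q) \<in> linked R" | "(p, y) \<in> linked R" "(x, q) \<in> linked R"
      by blast
    then have "(x, y) \<in> linked S"
    proof cases
      case 1
      then have "(p, x) \<in> linked S" "(y, q) \<in> linked S" using RS by blast+
      then show ?thesis using linked_trans[OF linked_trans[OF linked_sym pq'] linked_sym] by blast
    next
      case 2
      then have "(x, q) \<in> linked S" "(p, y) \<in> linked S" using RS by blast+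
      then show ?thesis using linked_trans[OF linked_trans[OF _ linked_sym[OF pq']]] by blast
    qed
    with xy show False ..
  qed
qed

text \<open>
  The minimal set \<open>P\<close> stands in for a path from \<open>x\<close> to \<open>y\<close>: no list of vertices is ever needed,
  only the fact that each of its edges is indispensable.
\<close>

lemma linked_minimal_subset:
  assumes "finite S" "(x, y) \<in> linked S"
  obtains P where "P \<subseteq> S" "(x, y) \<in> linked P" "\<And>f. f \<in> P \<Longrightarrow> (x, y) \<notin> linked (P - {f})"
proof -
  have "\<exists>P. P \<subseteq> S \<and> (x, y) \<in> linked P \<and> (\<forall>f\<in>P. (x, y) \<notin> linked (P - {f}))"
    using assms
  proof (induction "card S" arbitrary: S rule: less_induct)
    case less
    show ?case
    proof (cases "\<exists>f\<in>S. (x, y) \<in> linked (S - {f})")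
      case True
      then obtain f where "f \<in> S" "(x, y) \<in> linked (S - {f})" by blast
      with less.prems less.hyps[of "S - {f}"] obtain P
        where "P \<subseteq> S - {f}" "(x, y) \<in> linked P" "\<forall>f\<in>P. (x, y) \<notin> linked (P - {f})"
        by (metis card_Diff1_less finite_Diff)
      then show ?thesis by blast
    next
      case False
      then show ?thesis using less.prems by blast
    qed
  qed
  then show thesis using that by blast
qed

text \<open>
  An edge of the path joining \<open>x\<close> to \<open>y\<close> in a forest may be traded for the edge \<open>{x, y}\<close>. Removing
  \<open>f\<close> separates \<open>x\<close> from \<open>y\<close> in the whole forest and not only in \<open>P\<close>: a detour avoiding \<open>f\<close>,
  together with the two remaining pieces of the path, would link the ends of \<open>f\<close>.
\<close>

lemma forest_exchange:
  assumes S: "forest S" "P \<subseteq> S" and P: "(x, y) \<in> linked P"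
    and f: "f \<in> P" "(x, y) \<notin> linked (P - {f})" and two: "\<exists>p q. f = {p, q}"
  shows "forest (insert {x, y} (S - {f}))"
proof (rule forest_insert)
  show "forest (S - {f})" using S(1) by (rule forest_subset) auto
  from two obtain p q where pq: "f = {p, q}" by blast
  define R where "R = S - {f}"
  have "P = insert {p, q} (P - {f})" using f pq by auto
  then have "(x, y) \<in> linked (insert {p, q} (P - {f}))" using P by simp
  from linked_insertE[OF this] f(2)
  consider "(x, p) \<in> linked (P - {f})" "(q, y) \<in> linked (P - {f})"
    | "(x, q) \<in> linked (P - {f})" "(p, y) \<in> linked (P - {f})" by blast
  note split = this
  have PR: "linked (P - {f}) \<subseteq> linked R" unfolding R_def by (rule linked_mono) (use S in auto)
  have npq: "(p, q) \<notin> linked R" using forestD[OF S(1), of p q] S(2) f(1) pq by (auto simp: R_def)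
  have "(x, y) \<notin> linked R"
  proof
    assume xy: "(x, y) \<in> linked R"
    from split show False
    proof cases
      case 1
      then have "(x, p) \<in> linked R" "(q, y) \<in> linked R" using PR by blast+
      then have "(p, q) \<in> linked R" using linked_trans[OF linked_trans[OF linked_sym xy] linked_sym] by blast
      with npq show False ..
    next
      case 2
      then have "(p, y) \<in> linked R" "(x, q) \<in> linked R" using PR by blast+
      then have "(p, q) \<in> linked R" using linked_trans[OF linked_trans[OF _ linked_sym[OF xy]]] by blast
      with npq show False ..
    qed
  qed
  then show "(x, y) \<notin> linked (S - {f})" by (simp add: R_def)
qed

text \<open>
  The edge closing a cycle is not a bridge, since the remaining edges go around the other way.
\<close>

lemma forest_no_cycle:
  assumes "forest S"
  shows "\<not> is_graph_cycle S vs"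
proof
  assume c: "is_graph_cycle S vs"
  define n where "n = length vs - 1"
  have len: "length vs = Suc n" "n \<ge> 2" and d: "distinct vs"
    using c by (auto simp: is_graph_cycle_def n_def)
  have e: "{vs ! i, vs ! (Suc i mod Suc n)} \<in> S" if "i \<le> n" for i
    using c that len(1) by (simp add: is_graph_cycle_def)
  define T where "T = S - {{vs ! 0, vs ! n}}"
  have "(vs ! 0, vs ! i) \<in> linked T" if "i \<le> n" for i
    using that
  proof (induction i)
    case (Suc i)
    have "{vs ! i, vs ! Suc i} \<in> S" using e[of i] Suc.prems by simp
    moreover have "{vs ! i, vs ! Suc i} \<noteq> {vs ! 0, vs ! n}"
      using Suc.prems len d by (auto simp: doubleton_eq_iff nth_eq_iff_index_eq)
    ultimately have "(vs ! i, vs ! Suc i) \<in> linked T"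
      by (intro linked_edge) (simp add: T_def)
    then show ?case using Suc linked_trans by fastforce
  qed simp
  moreover have "{vs ! 0, vs ! n} \<in> S" using e[of n] by (simp add: insert_commute)
  ultimately show False using assms by (auto simp: forest_def T_def)
qed

definition link_classes :: "'a set \<Rightarrow> 'a set set \<Rightarrow> 'a set set" where
  "link_classes V S = (\<lambda>v. linked S `` {v}) ` V"

lemma linked_class_eq: "linked S `` {u} = linked S `` {v} \<longleftrightarrow> (u, v) \<in> linked S"
proof
  assume "linked S `` {u} = linked S `` {v}"
  moreover have "v \<in> linked S `` {v}" by simp
  ultimately have "v \<in> linked S `` {u}" by simp
  then show "(u, v) \<in> linked S" by simp
next
  assume uv: "(u, v) \<in> linked S"
  show "linked S `` {u} = linked S `` {v}"
  proof (intro equalityI subsetI)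
    fix w assume "w \<in> linked S `` {u}"
    then show "w \<in> linked S `` {v}" using linked_trans[OF linked_sym[OF uv], of w] by simp
  next
    fix w assume "w \<in> linked S `` {v}"
    then show "w \<in> linked S `` {u}" using linked_trans[OF uv, of w] by simp
  qed
qed

text \<open>
  The classes of the larger graph are the images of those of the smaller one, and two of the latter,
  those of \<open>x\<close> and \<open>y\<close>, have the same image.
\<close>

lemma card_link_classes_insert:
  assumes "finite V" "x \<in> V" "y \<in> V" "(x, y) \<notin> linked S"
  shows "card (link_classes V (insert {x, y} S)) < card (link_classes V S)"
proof -
  let ?S' = "insert {x, y} S"
  let ?g = "\<lambda>C. linked ?S' `` C"
  have sub: "linked S \<subseteq> linked ?S'" by (rule linked_mono) auto
  have g: "?g (linked S `` {v}) = linked ?S' `` {v}" for v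
  proof (intro equalityI subsetI)
    fix w assume "w \<in> ?g (linked S `` {v})"
    then obtain u where "(v, u) \<in> linked S" "(u, w) \<in> linked ?S'" by blast
    then show "w \<in> linked ?S' `` {v}" using sub linked_trans[of v u ?S' w] by blast
  next
    fix w assume "w \<in> linked ?S' `` {v}"
    then show "w \<in> ?g (linked S `` {v})" using linked_refl[of v S] by blast
  qed
  have im: "link_classes V ?S' = ?g ` link_classes V S"
    unfolding link_classes_def image_image g ..
  have "(x, y) \<in> linked ?S'" by (rule linked_edge) simp
  then have "?g (linked S `` {x}) = ?g (linked S `` {y})"
    unfolding g linked_class_eq .
  moreover have "linked S `` {x} \<noteq> linked S `` {y}" using assms(4) by (simp add: linked_class_eq)
  moreover have "linked S `` {x} \<in> link_classes V S" "linked S `` {y} \<in> link_classes V S"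
    using assms(2,3) by (auto simp: link_classes_def)
  ultimately have "\<not> inj_on ?g (link_classes V S)" by (meson inj_onD)
  moreover have "finite (link_classes V S)" using assms(1) by (simp add: link_classes_def)
  ultimately show ?thesis unfolding im
    by (metis card_image_le eq_card_imp_inj_on le_neq_implies_less)
qed

text \<open>
  Adding the edges of \<open>S - K\<close> one at a time merges classes at each step, because every edge of a
  forest is a bridge.
\<close>

lemma card_forest_diff_le:
  assumes V: "finite V" "\<And>e. e \<in> S \<Longrightarrow> \<exists>x\<in>V. \<exists>y\<in>V. e = {x, y}"
    and S: "finite S" "forest S" "K \<subseteq> S"
  shows "card (S - K) + card (link_classes V S) \<le> card (link_classes V K)"
proof -
  have "card J + card (link_classes V (K \<union> J)) \<le> card (link_classes V K)" if "J \<subseteq> S - K" "finite J" for J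
    using that(2,1)
  proof (induction J rule: finite_induct)
    case (insert e J)
    from insert.prems V(2) obtain x y where xy: "x \<in> V" "y \<in> V" "e = {x, y}" by blast
    have "(x, y) \<notin> linked (S - {e})" using S(2) insert.prems xy by (auto simp: forest_def)
    moreover have "linked (K \<union> J) \<subseteq> linked (S - {e})"
      by (rule linked_mono) (use insert S in auto)
    ultimately have "(x, y) \<notin> linked (K \<union> J)" by blast
    from card_link_classes_insert[OF V(1) xy(1,2) this]
    show ?case using insert xy by simp
  qed simp
  from this[of "S - K"] S show ?thesis by (simp add: Un_absorb1 Un_commute)
qed

section \<open>The tree packing theorem\<close>

definition forest_packing :: "'a set set \<Rightarrow> nat \<Rightarrow> (nat \<Rightarrow> 'a set set) \<Rightarrow> bool" where
  "forest_packing E k F \<longleftrightarrow>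
     (\<forall>i<k. F i \<subseteq> E \<and> forest (F i)) \<and> disjoint_family_on F {..<k}"

lemma maximum_forest_packing:
  assumes "finite E"
  obtains F where "forest_packing E k F"
    "\<And>F'. forest_packing E k F' \<Longrightarrow> card (\<Union>i<k. F' i) \<le> card (\<Union>i<k. F i)"
proof -
  have 0: "forest_packing E k (\<lambda>i. {})"
    by (auto simp: forest_packing_def forest_def disjoint_family_on_def)
  have "card (\<Union>i<k. F i) < Suc (card E)" if "forest_packing E k F" for F
    using card_mono[OF assms, of "\<Union>i<k. F i"] that by (auto simp: forest_packing_def less_Suc_eq_le)
  with 0 obtain F where "forest_packing E k F"
    "\<forall>F'. forest_packing E k F' \<longrightarrow> card (\<Union>i<k. F' i) \<le> card (\<Union>i<k. F i)"
    using ex_has_greatest_nat[of "forest_packing E k" _ "\<lambda>F. card (\<Union>i<k. F i)"] by metis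
  then show thesis using that by blast
qed

text \<open>
  The packings that can be reached from \<open>F\<close> by repeatedly bringing an unused edge \<open>e\<close> into some
  forest in place of an edge \<open>f\<close> of it.
\<close>

inductive exchanges :: "'a set set \<Rightarrow> nat \<Rightarrow> (nat \<Rightarrow> 'a set set) \<Rightarrow> (nat \<Rightarrow> 'a set set) \<Rightarrow> bool"
  for E k F where
  refl: "exchanges E k F F"
| swap: "exchanges E k F F' \<Longrightarrow> i < k \<Longrightarrow> e \<in> E - (\<Union>j<k. F' j) \<Longrightarrow> f \<in> F' i \<Longrightarrow>
     forest (insert e (F' i - {f})) \<Longrightarrow> exchanges E k F (F'(i := insert e (F' i - {f})))"

lemma card_Union_swap:
  fixes F :: "nat \<Rightarrow> 'a set"
  assumes "disjoint_family_on F {..<k}" "i < k" "e \<notin> (\<Union>j<k. F j)" "f \<in> F i" "\<And>j. j < k \<Longrightarrow> finite (F j)"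
  shows "card (\<Union>j<k. (F(i := insert e (F i - {f}))) j) = card (\<Union>j<k. F j)"
    and "disjoint_family_on (F(i := insert e (F i - {f}))) {..<k}"
proof -
  let ?U = "\<Union>j<k. F j"
  have d: "F j \<inter> F l = {}" if "j < k" "l < k" "j \<noteq> l" for j l
    using assms(1) that by (auto simp: disjoint_family_on_def)
  have "(\<Union>j<k. (F(i := insert e (F i - {f}))) j) = insert e (?U - {f})"
  proof (intro equalityI subsetI)
    fix g assume "g \<in> (\<Union>j<k. (F(i := insert e (F i - {f}))) j)"
    then obtain j where j: "j < k" "g \<in> (F(i := insert e (F i - {f}))) j" by blast
    show "g \<in> insert e (?U - {f})"
      using j assms(2,4) d[of i j] by (cases "j = i") auto
  next
    fix g assume g: "g \<in> insert e (?U - {f})"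
    show "g \<in> (\<Union>j<k. (F(i := insert e (F i - {f}))) j)"
    proof (cases "g = e")
      case True
      then show ?thesis using assms(2) by auto
    next
      case False
      with g obtain j where "j < k" "g \<in> F j" "g \<noteq> f" by auto
      then show ?thesis by (intro UN_I[of j]) auto
    qed
  qed
  moreover have "finite ?U" "f \<in> ?U" using assms by auto
  ultimately show "card (\<Union>j<k. (F(i := insert e (F i - {f}))) j) = card ?U"
    using assms(3) by (metis DiffD1 card.remove card_insert_disjoint finite_Diff)
  show "disjoint_family_on (F(i := insert e (F i - {f}))) {..<k}"
    unfolding disjoint_family_on_def
  proof (intro ballI impI)
    fix m n assume mn: "m \<in> {..<k}" "n \<in> {..<k}" "m \<noteq> n"
    then show "(F(i := insert e (F i - {f}))) m \<inter> (F(i := insert e (F i - {f}))) n = {}"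
      using d[of m n] assms(3) by auto
  qed
qed

lemma exchanges_packing:
  assumes "finite E" "forest_packing E k F" "exchanges E k F F'"
  shows "forest_packing E k F' \<and> card (\<Union>i<k. F' i) = card (\<Union>i<k. F i)"
  using assms(3)
proof induction
  case refl
  then show ?case using assms by simp
next
  case (swap F' i e f)
  have fin: "finite (F' j)" if "j < k" for j
    using swap.IH that assms(1) by (auto simp: forest_packing_def intro: finite_subset)
  have d: "disjoint_family_on F' {..<k}" using swap.IH by (simp add: forest_packing_def)
  have e: "e \<notin> (\<Union>j<k. F' j)" using swap by blast
  note new = card_Union_swap[OF d swap.hyps(2) e swap.hyps(4) fin]
  have "(F'(i := insert e (F' i - {f}))) j \<subseteq> E \<and> forest ((F'(i := insert e (F' i - {f}))) j)"
    if "j < k" for j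
    using swap that by (auto simp: forest_packing_def)
  then show ?case
    using new swap.IH unfolding forest_packing_def by simp
qed

lemma card_link_classes_pos: "finite V \<Longrightarrow> V \<noteq> {} \<Longrightarrow> card (link_classes V S) \<ge> 1"
  by (simp add: link_classes_def Suc_leI card_gt_0_iff)

text \<open>
  The harder implication of the Nash-Williams--Tutte theorem, with the partitions of \<open>V\<close> given as the
  classes of vertices linked by an edge set \<open>D\<close>.

  Start from a packing \<open>F\<close> with as many edges as possible, and let \<open>D\<close> be the set of all edges that
  are missed by some packing reachable from \<open>F\<close> by exchanges. By maximality an edge missed by a
  reachable packing has its ends joined in each of the forests of that packing, and every edge on the
  joining path can be exchanged out, hence lies in \<open>D\<close> too. An exchange therefore never links
  vertices inside \<open>D\<close> that were not linked before, so that each \<open>F i \<inter> D\<close> links exactly the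
  vertices that \<open>D\<close> links. An edge running between different classes of \<open>D\<close> is outside \<open>D\<close> and thus
  belongs to some \<open>F i\<close>, while \<open>F i - D\<close> has at most (number of classes of \<open>D\<close>) - (number of classes
  of \<open>F i\<close>) edges. Having \<open>k\<close> (number of classes of \<open>D\<close> - 1) crossing edges then forces every
  \<open>F i\<close> to have a single class.
\<close>

theorem nash_williams_tutte:
  assumes V: "finite V" "V \<noteq> {}" and E: "\<And>e. e \<in> E \<Longrightarrow> \<exists>x\<in>V. \<exists>y\<in>V. e = {x, y}"
    and cut: "\<And>D. D \<subseteq> E \<Longrightarrow>
      k * (card (link_classes V D) - 1) \<le> card {e \<in> E. \<not> (\<exists>C\<in>link_classes V D. e \<subseteq> C)}"
  obtains F where "forest_packing E k F" "\<And>i. i < k \<Longrightarrow> graph_connected V (F i)"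
proof -
  have "E \<subseteq> Pow V" using E by fastforce
  then have finE: "finite E" using V(1) by (meson finite_Pow_iff finite_subset)
  obtain F where F: "forest_packing E k F"
    and max: "\<And>F'. forest_packing E k F' \<Longrightarrow> card (\<Union>i<k. F' i) \<le> card (\<Union>i<k. F i)"
    using maximum_forest_packing[OF finE] by blast
  define D where "D = {e \<in> E. \<exists>F'. exchanges E k F F' \<and> e \<notin> (\<Union>i<k. F' i)}"
  \<comment> \<open>reachable packings are maximal too, so a missed edge closes a cycle in each of their forests,
      and each edge of that cycle is missed after a further exchange\<close>
  have joined: "(x, y) \<in> linked (F' i \<inter> D)"
    if F': "exchanges E k F F'" and i: "i < k" and xy: "{x, y} \<in> E - (\<Union>j<k. F' j)" for F' i x y
  proof -
    have pk: "forest_packing E k F'" "card (\<Union>i<k. F' i) = card (\<Union>i<k. F i)"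
      using exchanges_packing[OF finE F F'] by auto
    have fin: "finite (F' j)" if "j < k" for j
      using pk that finE by (auto simp: forest_packing_def intro: finite_subset)
    have fo: "forest (F' i)" "F' i \<subseteq> E" using pk i by (auto simp: forest_packing_def)
    have "(x, y) \<in> linked (F' i)"
    proof (rule ccontr)
      assume n: "(x, y) \<notin> linked (F' i)"
      let ?G = "F'(i := insert {x, y} (F' i))"
      have "(\<Union>j<k. ?G j) = insert {x, y} (\<Union>j<k. F' j)"
        using i by (auto split: if_splits)
      moreover have "finite (\<Union>j<k. F' j)" using fin by auto
      ultimately have c: "card (\<Union>j<k. ?G j) = Suc (card (\<Union>j<k. F' j))"
        using xy by simp
      have "disjoint_family_on ?G {..<k}"
        using pk(1) xy by (auto simp: forest_packing_def disjoint_family_on_def)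
      then have "forest_packing E k ?G"
        using pk(1) forest_insert[OF fo(1) n] xy by (auto simp: forest_packing_def)
      from max[OF this] show False using c pk(2) by simp
    qed
    then obtain P where P: "P \<subseteq> F' i" "(x, y) \<in> linked P"
      "\<And>f. f \<in> P \<Longrightarrow> (x, y) \<notin> linked (P - {f})"
      using linked_minimal_subset[OF fin[OF i]] by metis
    have "P \<subseteq> D"
    proof
      fix f assume f: "f \<in> P"
      let ?G = "F'(i := insert {x, y} (F' i - {f}))"
      have fE: "f \<in> E" using f P fo by blast
      then have "\<exists>p q. f = {p, q}" using E by blast
      then have "forest (insert {x, y} (F' i - {f}))"
        using forest_exchange[OF fo(1) P(1,2) f P(3)[OF f]] by blast
      then have ex: "exchanges E k F ?G"
        using exchanges.swap[OF F' i xy] f P(1) by blast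
      have "f \<notin> ?G j" if j: "j < k" for j
      proof (cases "j = i")
        case True
        then show ?thesis using f P(1) xy i by auto
      next
        case False
        then have "F' i \<inter> F' j = {}"
          using pk(1) i j by (simp add: forest_packing_def disjoint_family_on_def)
        then show ?thesis using False f P(1) by auto
      qed
      then show "f \<in> D" using ex fE unfolding D_def by blast
    qed
    then show ?thesis using P linked_mono[of P "F' i \<inter> D"] by blast
  qed
  \<comment> \<open>the edge brought in by an exchange joins vertices that \<open>F' i \<inter> D\<close> already links\<close>
  have stable: "linked (F' i \<inter> D) \<subseteq> linked (F i \<inter> D)" if "exchanges E k F F'" "i < k" for F' i
    using that(1)
  proof induction
    case (swap F' j e f)
    show ?case
    proof (cases "j = i")
      case True
      from swap.hyps(3) E[of e] obtain x y where xy: "e = {x, y}" by blast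
      have xyl: "(x, y) \<in> linked (F' i \<inter> D)"
        by (rule joined[OF swap.hyps(1) that(2) swap.hyps(3)[unfolded xy]])
      have "linked (insert e (F' i - {f}) \<inter> D) \<subseteq> linked (F' i \<inter> D)"
      proof (rule linked_least)
        fix p q assume "{p, q} \<in> insert e (F' i - {f}) \<inter> D"
        then consider "p = x \<and> q = y \<or> p = y \<and> q = x" | "{p, q} \<in> F' i \<inter> D"
          using xy by (auto simp: doubleton_eq_iff)
        then show "(p, q) \<in> linked (F' i \<inter> D)"
          using xyl linked_sym[OF xyl] linked_edge[of p q] by cases auto
      qed
      then show ?thesis using swap.IH True by simp
    next
      case False
      then show ?thesis using swap.IH by simp
    qed
  qed simp
  have span: "linked D = linked (F i \<inter> D)" if i: "i < k" for i
  proof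
    show "linked (F i \<inter> D) \<subseteq> linked D" by (rule linked_mono) auto
    show "linked D \<subseteq> linked (F i \<inter> D)"
    proof (rule linked_least)
      fix x y assume "{x, y} \<in> D"
      then obtain F' where "exchanges E k F F'" "{x, y} \<in> E - (\<Union>i<k. F' i)"
        by (auto simp: D_def)
      with joined[OF _ i] stable[OF _ i] show "(x, y) \<in> linked (F i \<inter> D)" by (meson subsetD)
    qed
  qed
  define c where "c = card (link_classes V D)"
  define X where "X = {e \<in> E. \<not> (\<exists>C\<in>link_classes V D. e \<subseteq> C)}"
  have X: "X \<subseteq> (\<Union>i<k. F i - D)"
  proof
    fix e assume e: "e \<in> X"
    then obtain x y where xy: "x \<in> V" "e = {x, y}" "e \<in> E" using E by (force simp: X_def)
    have "e \<notin> D"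
    proof
      assume "e \<in> D"
      then have "(x, y) \<in> linked D" using xy linked_edge by metis
      then have "e \<subseteq> linked D `` {x}" using xy by auto
      then show False using e xy by (auto simp: X_def link_classes_def)
    qed
    moreover from this have "e \<in> (\<Union>i<k. F i)" using xy exchanges.refl[of E k F] by (auto simp: D_def)
    ultimately show "e \<in> (\<Union>i<k. F i - D)" by blast
  qed
  have finF: "finite (F i)" if "i < k" for i
    using F that finE by (auto simp: forest_packing_def intro: finite_subset)
  have part: "card (F i - D) + card (link_classes V (F i)) \<le> c" if i: "i < k" for i
  proof -
    have "card (F i - F i \<inter> D) + card (link_classes V (F i)) \<le> card (link_classes V (F i \<inter> D))"
      by (rule card_forest_diff_le) (use V E F i finF in \<open>auto simp: forest_packing_def\<close>)
    also have "link_classes V (F i \<inter> D) = link_classes V D" by (simp add: link_classes_def span[OF i])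
    finally show ?thesis by (simp add: c_def Diff_Int)
  qed
  have "k * (c - 1) \<le> card X" unfolding c_def X_def by (rule cut) (auto simp: D_def)
  also have "\<dots> \<le> card (\<Union>i<k. F i - D)" by (rule card_mono) (use X finF in auto)
  also have "\<dots> \<le> (\<Sum>i<k. card (F i - D))" by (rule card_UN_le) simp
  finally have total: "k * (c - 1) \<le> (\<Sum>i<k. card (F i - D))" .
  \<comment> \<open>one forest with a second class would make the sum of the bounds in \<open>part\<close> fall below \<open>total\<close>\<close>
  have one: "card (link_classes V (F i)) = 1" if i: "i < k" for i
  proof (rule ccontr)
    assume n: "card (link_classes V (F i)) \<noteq> 1"
    have "(\<Sum>i<k. card (F i - D)) < (\<Sum>i<k. c - 1)"
    proof (rule sum_strict_mono_ex1)
      show "\<forall>j\<in>{..<k}. card (F j - D) \<le> c - 1"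
      proof
        fix j assume "j \<in> {..<k}"
        then show "card (F j - D) \<le> c - 1" using part[of j] card_link_classes_pos[OF V, of "F j"] by simp
      qed
      show "\<exists>j\<in>{..<k}. card (F j - D) < c - 1"
        using part[OF i] card_link_classes_pos[OF V, of "F i"] n i by (intro bexI[of _ i]) auto
    qed simp
    then show False using total by simp
  qed
  have "graph_connected V (F i)" if i: "i < k" for i
    unfolding graph_connected_def linked_def[symmetric]
  proof (intro ballI)
    fix u v assume "u \<in> V" "v \<in> V"
    then have "linked (F i) `` {u} \<in> link_classes V (F i)" "linked (F i) `` {v} \<in> link_classes V (F i)"
      by (auto simp: link_classes_def)
    then have "linked (F i) `` {u} = linked (F i) `` {v}"
      using one[OF i] by (metis card_1_singletonE singletonD)
    then show "(u, v) \<in> linked (F i)" by (simp only: linked_class_eq)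
  qed
  with F show thesis using that by blast
qed

section \<open>Eigenfunctions and roots of the characteristic polynomial\<close>

text \<open>
  Cramer's rule, applied once for each replaced column. The matrix serves to complete two independent
  vectors to a basis by unit vectors.
\<close>

lemma det_identity_two_columns_replaced:
  fixes u w :: "nat \<Rightarrow> 'a :: field"
  assumes ij: "i < n" "j < n" "i \<noteq> j" and ui: "u i \<noteq> 0"
  shows "det (mat n n (\<lambda>(r, s). if s = j then w r else if s = i then u r else if r = s then 1 else 0))
           = u i * w j - u j * w i"
proof -
  \<comment> \<open>\<open>?A\<close> has only column \<open>i\<close> replaced, and \<open>?x\<close> is the solution of \<open>?A x = w\<close>\<close>
  let ?A = "mat n n (\<lambda>(r, s). if s = i then u r else if r = s then 1 else 0)"
  let ?x = "vec n (\<lambda>r. if r = i then w i / u i else w r - u r * (w i / u i))"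
  have A: "?A \<in> carrier_mat n n" by simp
  have "?A = replace_col (1\<^sub>m n) (1\<^sub>m n *\<^sub>v vec n u) i"
    by (rule eq_matI) (auto simp: replace_col_def)
  then have detA: "det ?A = u i"
    using cramer_lemma_mat[of "1\<^sub>m n" n "vec n u" i] ij by simp
  have "?A *\<^sub>v ?x = vec n w"
  proof (rule eq_vecI)
    fix r assume "r < dim_vec (vec n w)"
    then have r: "r < n" by simp
    have "(?A *\<^sub>v ?x) $ r = (\<Sum>s\<in>{0..<n}. ?A $$ (r, s) * ?x $ s)"
      using r by (simp add: scalar_prod_def)
    also have "\<dots> = (\<Sum>s\<in>{0..<n}. (if s = i then u r * (w i / u i) else 0)
                       + (if s = r then (if r = i then 0 else w r - u r * (w i / u i)) else 0))"
      by (rule sum.cong) (use r in auto)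
    also have "\<dots> = w r"
      using r ij ui by (simp add: sum.distrib)
    finally show "(?A *\<^sub>v ?x) $ r = vec n w $ r" using r by simp
  qed simp
  moreover have "mat n n (\<lambda>(r, s). if s = j then w r else if s = i then u r else if r = s then 1 else 0)
      = replace_col ?A (vec n w) j"
    by (rule eq_matI) (auto simp: replace_col_def)
  ultimately have "det (mat n n (\<lambda>(r, s). if s = j then w r else if s = i then u r else if r = s then 1 else 0))
      = ?x $ j * u i"
    using cramer_lemma_mat[OF A, of ?x j] ij detA by simp
  also have "\<dots> = u i * w j - u j * w i"
    using ij ui by (simp add: field_simps)
  finally show ?thesis .
qed

text \<open>
  Two independent eigenvectors contribute two factors even if their eigenvalues coincide, so that
  algebraic multiplicities are controlled without diagonalising \<open>A\<close>. With \<open>P\<close> the identity matrix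
  having \<open>u\<close> and \<open>w\<close> in the columns \<open>i\<close> and \<open>j\<close>, the same columns of \<open>(x I - A) P\<close> are \<open>(x - l) u\<close>
  and \<open>(x - m) w\<close>. Pulling the factors out writes the product as \<open>Q D\<close> with a diagonal \<open>D\<close>, and the
  determinant of \<open>P\<close> is a nonzero constant.
\<close>

lemma char_poly_dvd_two_eigenvectors:
  fixes A :: "'a :: field mat" and u w :: "nat \<Rightarrow> 'a"
  assumes A: "A \<in> carrier_mat n n"
    and ij: "i < n" "j < n" and minor: "u i * w j \<noteq> u j * w i" and ui: "u i \<noteq> 0"
    and u: "\<And>r. r < n \<Longrightarrow> (\<Sum>s<n. A $$ (r, s) * u s) = l * u r"
    and w: "\<And>r. r < n \<Longrightarrow> (\<Sum>s<n. A $$ (r, s) * w s) = m * w r"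
  shows "[:- l, 1:] * [:- m, 1:] dvd char_poly A"
proof -
  have ne: "i \<noteq> j" using minor by auto
  let ?P = "mat n n (\<lambda>(r, s). if s = j then w r else if s = i then u r else if r = s then 1 else 0)"
  let ?PP = "map_mat (\<lambda>a. [:a:]) ?P"
  let ?M = "char_poly_matrix A"
  let ?Q = "mat n n (\<lambda>(r, s). if s = j then [:w r:] else if s = i then [:u r:] else ?M $$ (r, s))"
  let ?D = "mat n n (\<lambda>(r, s). if r = s then (if s = j then [:- m, 1:] else if s = i then [:- l, 1:] else 1) else 0)"
  have M: "?M \<in> carrier_mat n n" using A by simp
  have Mrs: "?M $$ (r, s) = (if r = s then [:0, 1:] else 0) + [:- A $$ (r, s):]" if "r < n" "s < n" for r s
    using that A by (auto simp: char_poly_matrix_def)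
  have col: "(\<Sum>t<n. ?M $$ (r, t) * [:v t:]) = [:v r:] * [:- c, 1:]"
    if r: "r < n" and v: "(\<Sum>s<n. A $$ (r, s) * v s) = c * v r" for r v c
  proof -
    have "(\<Sum>t<n. ?M $$ (r, t) * [:v t:])
            = (\<Sum>t<n. (if t = r then [:0, v r:] else 0) - [:A $$ (r, t) * v t:])"
      by (rule sum.cong) (use r Mrs in auto)
    also have "\<dots> = [:0, v r:] - (\<Sum>t<n. [:A $$ (r, t) * v t:])"
      using r by (simp add: sum_subtractf)
    also have "(\<Sum>t<n. [:A $$ (r, t) * v t:]) = [:\<Sum>t<n. A $$ (r, t) * v t:]"
      by (induction n) auto
    finally show ?thesis using v by simp
  qed
  have "?M * ?PP = ?Q * ?D"
  proof (rule eq_matI)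
    fix r s assume "r < dim_row (?Q * ?D)" "s < dim_col (?Q * ?D)"
    then have rs: "r < n" "s < n" by auto
    have "(?M * ?PP) $$ (r, s) = (\<Sum>t<n. ?M $$ (r, t) * ?PP $$ (t, s))"
      using rs M by (simp add: scalar_prod_def atLeast0LessThan)
    also have "\<dots> = ?Q $$ (r, s) * ?D $$ (s, s)"
    proof -
      consider "s = j" | "s = i" "s \<noteq> j" | "s \<noteq> i" "s \<noteq> j" by blast
      then show ?thesis
      proof cases
        case 1
        have "(\<Sum>t<n. ?M $$ (r, t) * ?PP $$ (t, s)) = (\<Sum>t<n. ?M $$ (r, t) * [:w t:])"
          by (rule sum.cong) (use 1 ij in auto)
        then show ?thesis using col[OF rs(1) w[OF rs(1)]] 1 rs by simp
      next
        case 2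
        have "(\<Sum>t<n. ?M $$ (r, t) * ?PP $$ (t, s)) = (\<Sum>t<n. ?M $$ (r, t) * [:u t:])"
          by (rule sum.cong) (use 2 ij in auto)
        then show ?thesis using col[OF rs(1) u[OF rs(1)]] 2 rs by simp
      next
        case 3
        have "(\<Sum>t<n. ?M $$ (r, t) * ?PP $$ (t, s)) = (\<Sum>t<n. if t = s then ?M $$ (r, s) else 0)"
          by (rule sum.cong) (use 3 rs in \<open>auto simp: one_pCons[symmetric]\<close>)
        then show ?thesis using 3 rs by simp
      qed
    qed
    also have "\<dots> = (\<Sum>t<n. if t = s then ?Q $$ (r, s) * ?D $$ (s, s) else 0)"
      using rs by simp
    also have "\<dots> = (\<Sum>t<n. ?Q $$ (r, t) * ?D $$ (t, s))"
      by (rule sum.cong) (use rs in auto)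
    also have "\<dots> = (?Q * ?D) $$ (r, s)"
      using rs by (simp add: scalar_prod_def atLeast0LessThan)
    finally show "(?M * ?PP) $$ (r, s) = (?Q * ?D) $$ (r, s)" .
  qed (use A in \<open>auto simp: char_poly_matrix_def\<close>)
  then have "det ?M * det ?PP = det ?Q * det ?D"
    using det_mult[OF M, of ?PP] det_mult[of ?Q n ?D] by simp
  moreover have "det ?PP = [:u i * w j - u j * w i:]"
  proof -
    interpret c: comm_ring_hom "\<lambda>a :: 'a. [:a:]"
      by unfold_locales (auto simp: one_pCons)
    show ?thesis
      using det_identity_two_columns_replaced[where u = u and w = w, OF ij ne ui] c.hom_det[of ?P] by simp
  qed
  moreover have "det ?D = [:- l, 1:] * [:- m, 1:]"
  proof -
    have "det ?D = prod_list (diag_mat ?D)"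
      by (rule det_upper_triangular[of _ n]) auto
    also have "\<dots> = (\<Prod>s = 0..<n. ?D $$ (s, s))"
      by (simp only: prod_list_diag_prod) simp
    also have "\<dots> = (\<Prod>s\<in>{i, j}. ?D $$ (s, s))"
      by (rule prod.mono_neutral_right) (use ij in auto)
    also have "\<dots> = [:- l, 1:] * [:- m, 1:]"
      using ne ij by simp
    finally show ?thesis .
  qed
  ultimately have "char_poly A * [:u i * w j - u j * w i:] = det ?Q * ([:- l, 1:] * [:- m, 1:])"
    unfolding char_poly_def by (simp only:)
  then have "[:- l, 1:] * [:- m, 1:] dvd char_poly A * [:u i * w j - u j * w i:]"
    by (simp only: dvd_triv_right)
  also have "char_poly A * [:u i * w j - u j * w i:] = Polynomial.smult (u i * w j - u j * w i) (char_poly A)"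
    by simp
  finally show ?thesis using minor by (simp add: dvd_smult_iff)
qed

text \<open>
  If the second entry were at most \<open>\<theta>\<close>, only the first could exceed \<open>\<theta>\<close>.
\<close>

lemma second_of_descending_gt:
  fixes \<theta> :: "'a :: linorder"
  assumes "{#l, m#} \<subseteq># M" "l > \<theta>" "m > \<theta>"
  shows "rev (sorted_list_of_multiset M) ! 1 > \<theta>"
proof (rule ccontr)
  define xs where "xs = rev (sorted_list_of_multiset M)"
  assume "\<not> rev (sorted_list_of_multiset M) ! 1 > \<theta>"
  then have n: "xs ! 1 \<le> \<theta>" by (simp add: xs_def)
  have M: "mset xs = M" by (simp add: xs_def)
  have s: "sorted (rev xs)" by (simp add: xs_def)
  have "length xs \<ge> 2" using size_mset_mono[OF assms(1)] M size_mset[of xs] by simp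
  then obtain y z ys where xs: "xs = y # z # ys"
    by (cases xs; cases "tl xs") auto
  have "\<forall>t\<in>set (z # ys). t \<le> z" using s xs by (auto simp: sorted_append)
  then have "filter_mset (\<lambda>t. t > \<theta>) (mset (z # ys)) = {#}"
    using n xs by (auto simp: filter_mset_eq_mempty_iff)
  then have "size (filter_mset (\<lambda>t. t > \<theta>) M) \<le> 1" using M xs by (auto simp flip: M)
  moreover have "size (filter_mset (\<lambda>t. t > \<theta>) {#l, m#}) \<le> size (filter_mset (\<lambda>t. t > \<theta>) M)"
    by (intro size_mset_mono multiset_filter_mono assms)
  ultimately show False using assms(2,3) by simp
qed

definition adj :: "'a set set \<Rightarrow> 'a \<Rightarrow> 'a \<Rightarrow> real" where
  "adj E v w = (if {v, w} \<in> E then 1 else 0)"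

lemma adj_sym: "adj E v w = adj E w v"
  by (simp add: adj_def insert_commute)

lemma second_eigenvalue_gt:
  fixes f g :: "'a \<Rightarrow> real"
  assumes V: "finite V"
    and f: "\<And>v. v \<in> V \<Longrightarrow> (\<Sum>w\<in>V. adj E v w * f w) = l * f v" "\<exists>v\<in>V. f v \<noteq> 0" "l > \<theta>"
    and g: "\<And>v. v \<in> V \<Longrightarrow> (\<Sum>w\<in>V. adj E v w * g w) = m * g v" "\<exists>v\<in>V. g v \<noteq> 0" "m > \<theta>"
    and orth: "(\<Sum>v\<in>V. f v * g v) = 0"
  shows "graph_eigenvalue V E 2 > \<theta>"
proof -
  define vs where "vs = vertex_list V"
  have "\<exists>vs. distinct vs \<and> set vs = V" using finite_distinct_list[OF V] by blast
  then have vs: "distinct vs" "set vs = V"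
    unfolding vs_def vertex_list_def by (metis (mono_tags, lifting) someI_ex)+
  define n where "n = card V"
  have n: "length vs = n" using distinct_card[OF vs(1)] vs(2) by (simp add: n_def)
  have bij: "bij_betw (\<lambda>i. vs ! i) {..<n} V" using bij_betw_nth[OF vs(1)] vs(2) n by blast
  let ?A = "adjacency_matrix V E"
  have A: "?A \<in> carrier_mat n n" by (simp add: adjacency_matrix_def n_def)
  have row: "(\<Sum>s<n. ?A $$ (r, s) * h (vs ! s)) = c * h (vs ! r)"
    if r: "r < n" and h: "\<And>v. v \<in> V \<Longrightarrow> (\<Sum>w\<in>V. adj E v w * h w) = c * h v"
    for r h and c :: real
  proof -
    have "(\<Sum>s<n. ?A $$ (r, s) * h (vs ! s)) = (\<Sum>s<n. adj E (vs ! r) (vs ! s) * h (vs ! s))"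
      by (rule sum.cong) (use r in \<open>auto simp: adjacency_matrix_def adj_def vs_def n_def\<close>)
    also have "\<dots> = (\<Sum>w\<in>V. adj E (vs ! r) w * h w)"
      by (rule sum.reindex_bij_betw[OF bij])
    also have "\<dots> = c * h (vs ! r)" by (rule h) (use r n vs in auto)
    finally show ?thesis .
  qed
  have idx: "\<exists>i<n. vs ! i = v" if "v \<in> V" for v
    using that vs n by (metis in_set_conv_nth)
  obtain p where p: "p \<in> V" "f p \<noteq> 0" using f(2) by blast
  \<comment> \<open>orthogonality makes \<open>f\<close> and \<open>g\<close> independent, so that they have a nonzero minor\<close>
  have "\<exists>q\<in>V. f p * g q \<noteq> f q * g p"
  proof (rule ccontr)
    assume "\<not> (\<exists>q\<in>V. f p * g q \<noteq> f q * g p)"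
    then have e: "f p * g q = f q * g p" if "q \<in> V" for q using that by blast
    have "0 = (\<Sum>v\<in>V. f v * (f p * g v))"
      by (simp add: mult.left_commute[of _ "f p"] sum_distrib_left[symmetric] orth)
    also have "\<dots> = (\<Sum>v\<in>V. g p * (f v)\<^sup>2)"
      by (rule sum.cong) (auto simp: e power2_eq_square)
    also have "\<dots> = g p * (\<Sum>v\<in>V. (f v)\<^sup>2)" by (simp add: sum_distrib_left)
    finally have "g p = 0 \<or> (\<Sum>v\<in>V. (f v)\<^sup>2) = 0" by simp
    moreover have "(\<Sum>v\<in>V. (f v)\<^sup>2) \<noteq> 0" using p V by (auto simp: sum_nonneg_eq_0_iff)
    ultimately have "g q = 0" if "q \<in> V" for q using e[OF that] p by simp
    with g(2) show False by blast
  qed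
  then obtain q where q: "q \<in> V" "f p * g q \<noteq> f q * g p" by blast
  obtain i j where ij: "i < n" "vs ! i = p" "j < n" "vs ! j = q" using idx p q by metis
  have "[:- l, 1:] * [:- m, 1:] dvd char_poly ?A"
    by (rule char_poly_dvd_two_eigenvectors[OF A ij(1,3), of "\<lambda>r. f (vs ! r)" "\<lambda>r. g (vs ! r)"])
      (use ij p q row f(1) g(1) in auto)
  then obtain c where c: "char_poly ?A = [:- l, 1:] * [:- m, 1:] * c" by (rule dvdE)
  have "char_poly ?A \<noteq> 0" using degree_monic_char_poly[OF A] by auto
  then have "c \<noteq> 0" using c by auto
  have "proots (char_poly ?A) = proots [:- l, 1:] + proots [:- m, 1:] + proots c"
    unfolding c using \<open>c \<noteq> 0\<close>
    by (simp add: proots_mult del: mult_pCons_left mult_pCons_right proots_linear_factor)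
  also have "\<dots> = {#l, m#} + proots c" by simp
  finally have "proots (char_poly ?A) = {#l, m#} + proots c" .
  then have "{#l, m#} \<subseteq># proots (char_poly ?A)" by (metis mset_subset_eq_add_left)
  from second_of_descending_gt[OF this f(3) g(3)]
  show ?thesis by (simp add: graph_eigenvalue_def graph_eigenvalues_def)
qed

section \<open>The quadratic form of the adjacency matrix\<close>

text \<open>
  Functions on \<open>V\<close> are represented by functions on the whole type that vanish outside \<open>V\<close>; the
  unit functions among them form a closed subset of a product of compact intervals, to which
  Tychonoff's theorem applies.
\<close>

lemma compact_unit_sphere_orthogonal:
  fixes u :: "'a \<Rightarrow> real"
  assumes "finite V"
  shows "compact {f. (\<forall>v. v \<notin> V \<longrightarrow> f v = 0) \<and> (\<Sum>v\<in>V. (f v)\<^sup>2) = 1 \<and> (\<Sum>v\<in>V. u v * f v) = 0}"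
proof -
  let ?B = "Pi\<^sub>E UNIV (\<lambda>v. if v \<in> V then {-1..1::real} else {0})"
  have "compactin (product_topology (\<lambda>_. euclideanreal) (UNIV :: 'a set)) ?B"
    by (subst compactin_PiE) auto
  then have "compact ?B" by (simp add: euclidean_product_topology)
  moreover have "closed {f :: 'a \<Rightarrow> real. (\<Sum>v\<in>V. (f v)\<^sup>2) = 1}"
    by (intro closed_Collect_eq continuous_intros continuous_on_product_coordinates)
  moreover have "closed {f :: 'a \<Rightarrow> real. (\<Sum>v\<in>V. u v * f v) = 0}"
    by (intro closed_Collect_eq continuous_intros continuous_on_product_coordinates)
  ultimately have "compact (?B \<inter> {f. (\<Sum>v\<in>V. (f v)\<^sup>2) = 1} \<inter> {f. (\<Sum>v\<in>V. u v * f v) = 0})"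
    by (intro compact_Int_closed)
  also have "?B \<inter> {f. (\<Sum>v\<in>V. (f v)\<^sup>2) = 1} \<inter> {f. (\<Sum>v\<in>V. u v * f v) = 0}
      = {f. (\<forall>v. v \<notin> V \<longrightarrow> f v = 0) \<and> (\<Sum>v\<in>V. (f v)\<^sup>2) = 1 \<and> (\<Sum>v\<in>V. u v * f v) = 0}"
  proof -
    have "f v \<in> {-1..1}" if "(\<Sum>v\<in>V. (f v)\<^sup>2) = 1" "v \<in> V" for f :: "'a \<Rightarrow> real" and v
    proof -
      have "(f v)\<^sup>2 \<le> (\<Sum>v\<in>V. (f v)\<^sup>2)" by (rule member_le_sum) (use that assms in auto)
      then have "\<bar>f v\<bar> \<le> 1" using that by (simp add: abs_square_le_1)
      then show ?thesis by auto
    qed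
    then show ?thesis by (auto simp: PiE_def Pi_def split: if_splits)
  qed
  finally show ?thesis .
qed

text \<open>
  Let \<open>g\<close> maximise the quadratic form \<open>Q\<close> among the unit functions orthogonal to \<open>u\<close>, and let \<open>m\<close> be
  the maximum. The residual \<open>r = m g - a g\<close> is again orthogonal to \<open>u\<close>, because \<open>u\<close> is an
  eigenfunction and \<open>a\<close> is symmetric. Moving from \<open>g\<close> in the direction of \<open>r\<close> would lower
  \<open>m N - Q\<close> below its minimum 0 to first order, unless \<open>r = 0\<close>.
\<close>

lemma eigenfunction_from_large_quadratic_form:
  fixes a :: "'a \<Rightarrow> 'a \<Rightarrow> real" and u h :: "'a \<Rightarrow> real"
  assumes V: "finite V" and sym: "\<And>v w. a v w = a w v"
    and u: "\<And>v. v \<in> V \<Longrightarrow> (\<Sum>w\<in>V. a v w * u w) = l * u v"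
    and h: "(\<Sum>v\<in>V. u v * h v) = 0"
    and large: "(\<Sum>v\<in>V. \<Sum>w\<in>V. a v w * h v * h w) > \<theta> * (\<Sum>v\<in>V. (h v)\<^sup>2)"
  obtains g m where "m > \<theta>" "\<And>v. v \<in> V \<Longrightarrow> (\<Sum>w\<in>V. a v w * g w) = m * g v"
    "\<exists>v\<in>V. g v \<noteq> 0" "(\<Sum>v\<in>V. u v * g v) = 0"
proof -
  define Q where "Q f = (\<Sum>v\<in>V. \<Sum>w\<in>V. a v w * f v * f w)" for f :: "'a \<Rightarrow> real"
  define N where "N f = (\<Sum>v\<in>V. (f v)\<^sup>2)" for f :: "'a \<Rightarrow> real"
  define S where "S = {f. (\<forall>v. v \<notin> V \<longrightarrow> f v = 0) \<and> N f = 1 \<and> (\<Sum>v\<in>V. u v * f v) = 0}"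
  have N0: "N f \<ge> 0" for f by (simp add: N_def sum_nonneg)
  have N0iff: "N f = 0 \<longleftrightarrow> (\<forall>v\<in>V. f v = 0)" for f
    using V by (simp add: N_def sum_nonneg_eq_0_iff)
  have Q0: "Q f = 0" if "N f = 0" for f
    using that unfolding N0iff by (simp add: Q_def)
  have unit: "(\<lambda>v. if v \<in> V then f v / sqrt (N f) else 0) \<in> S
      \<and> Q (\<lambda>v. if v \<in> V then f v / sqrt (N f) else 0) = Q f / N f"
    if orth: "(\<Sum>v\<in>V. u v * f v) = 0" and pos: "N f > 0" for f
  proof -
    let ?e = "\<lambda>v. if v \<in> V then f v / sqrt (N f) else 0"
    have "N ?e = (\<Sum>v\<in>V. (f v)\<^sup>2 / N f)"
      unfolding N_def[of ?e] by (rule sum.cong) (use pos in \<open>auto simp: power_divide\<close>)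
    also have "\<dots> = 1" using pos by (simp add: sum_divide_distrib[symmetric] N_def)
    finally have 1: "N ?e = 1" .
    have "(\<Sum>v\<in>V. u v * ?e v) = (\<Sum>v\<in>V. u v * f v / sqrt (N f))"
      by (rule sum.cong) auto
    also have "\<dots> = 0" using orth by (simp add: sum_divide_distrib[symmetric])
    finally have 2: "(\<Sum>v\<in>V. u v * ?e v) = 0" .
    have "Q ?e = (\<Sum>v\<in>V. \<Sum>w\<in>V. a v w * f v * f w / N f)"
      unfolding Q_def by (intro sum.cong refl) (use pos in auto)
    also have "\<dots> = Q f / N f" by (simp add: Q_def sum_divide_distrib)
    finally show ?thesis using 1 2 by (simp add: S_def)
  qed
  have "N h \<noteq> 0" using Q0[of h] large by (auto simp: Q_def N_def)
  then have Nh: "N h > 0" using N0[of h] by simp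
  have "compact S"
    unfolding S_def N_def by (rule compact_unit_sphere_orthogonal[OF V])
  moreover have "S \<noteq> {}" using unit[OF h Nh] by blast
  moreover have "continuous_on S Q"
    unfolding Q_def by (intro continuous_intros continuous_on_subset[OF continuous_on_product_coordinates]) auto
  ultimately obtain g where g: "g \<in> S" "\<And>f. f \<in> S \<Longrightarrow> Q f \<le> Q g"
    using continuous_attains_sup[of S Q] by blast
  define m where "m = Q g"
  have g1: "N g = 1" "(\<Sum>v\<in>V. u v * g v) = 0" using g(1) by (auto simp: S_def)
  have le: "Q f \<le> m * N f" if orth: "(\<Sum>v\<in>V. u v * f v) = 0" for f
  proof (cases "N f = 0")
    case True
    then show ?thesis using Q0 by simp
  next
    case False
    then have pos: "N f > 0" using N0[of f] by simp
    have "Q f / N f \<le> m" using unit[OF orth pos] g(2) m_def by metis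
    then show ?thesis using pos by (simp add: field_simps)
  qed
  have "m > \<theta>"
  proof -
    have "\<theta> * N h < Q h" using large by (simp add: Q_def N_def)
    also have "\<dots> \<le> m * N h" by (rule le[OF h])
    finally show ?thesis using Nh by simp
  qed
  define r where "r v = m * g v - (\<Sum>w\<in>V. a v w * g w)" for v
  have "(\<Sum>v\<in>V. u v * (\<Sum>w\<in>V. a v w * g w)) = (\<Sum>v\<in>V. \<Sum>w\<in>V. a w v * u v * g w)"
    by (simp add: sum_distrib_left sym mult_ac)
  also have "\<dots> = (\<Sum>w\<in>V. (\<Sum>v\<in>V. a w v * u v) * g w)"
    by (subst sum.swap) (simp add: sum_distrib_right)
  also have "\<dots> = l * (\<Sum>w\<in>V. u w * g w)"
    by (simp add: u sum_distrib_left mult.assoc)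
  finally have "(\<Sum>v\<in>V. u v * (\<Sum>w\<in>V. a v w * g w)) = 0" using g1 by simp
  moreover have "(\<Sum>v\<in>V. u v * r v) = m * (\<Sum>v\<in>V. u v * g v) - (\<Sum>v\<in>V. u v * (\<Sum>w\<in>V. a v w * g w))"
    by (simp add: r_def right_diff_distrib sum_subtractf sum_distrib_left mult_ac)
  ultimately have r_orth: "(\<Sum>v\<in>V. u v * r v) = 0" using g1 by simp
  define B where "B = (\<Sum>v\<in>V. r v * (\<Sum>w\<in>V. a v w * g w))"
  define I where "I = (\<Sum>v\<in>V. r v * g v)"
  have NB: "m * I - B = N r"
    unfolding I_def B_def N_def sum_distrib_left[of m] sum_subtractf[symmetric]
  proof (rule sum.cong)
    fix v
    show "m * (r v * g v) - r v * (\<Sum>w\<in>V. a v w * g w) = (r v)\<^sup>2"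
      using r_def[of v] by (simp only: power2_eq_square right_diff_distrib mult_ac)
  qed simp
  have Nt: "N (\<lambda>v. g v + t * r v) = 1 + 2 * t * I + t\<^sup>2 * N r" for t
  proof -
    have "N (\<lambda>v. g v + t * r v) = N g + 2 * t * I + t\<^sup>2 * N r"
      unfolding N_def I_def sum_distrib_left sum.distrib[symmetric]
      by (rule sum.cong) (auto simp: power2_eq_square algebra_simps)
    then show ?thesis using g1 by simp
  qed
  have Qt: "Q (\<lambda>v. g v + t * r v) = m + 2 * t * B + t\<^sup>2 * Q r" for t
  proof -
    have 1: "B = (\<Sum>v\<in>V. \<Sum>w\<in>V. a v w * r v * g w)"
      by (simp add: B_def sum_distrib_left mult_ac)
    have "B = (\<Sum>v\<in>V. \<Sum>w\<in>V. a w v * r w * g v)"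
      unfolding 1 by (rule sum.swap)
    then have 2: "B = (\<Sum>v\<in>V. \<Sum>w\<in>V. a v w * g v * r w)"
      by (simp add: sym mult_ac)
    have "Q (\<lambda>v. g v + t * r v)
        = Q g + t * (\<Sum>v\<in>V. \<Sum>w\<in>V. a v w * r v * g w)
          + t * (\<Sum>v\<in>V. \<Sum>w\<in>V. a v w * g v * r w) + t\<^sup>2 * Q r"
      unfolding Q_def sum_distrib_left sum.distrib[symmetric]
      by (intro sum.cong refl) (simp_all add: power2_eq_square algebra_simps)
    then show ?thesis unfolding 1[symmetric] 2[symmetric] m_def by simp
  qed
  define c where "c = m * N r - Q r"
  have c0: "c \<ge> 0" using le[OF r_orth] by (simp add: c_def)
  have quad: "0 \<le> 2 * t * N r + t\<^sup>2 * c" for t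
  proof -
    have "(\<Sum>v\<in>V. u v * (g v + t * r v)) = (\<Sum>v\<in>V. u v * g v) + t * (\<Sum>v\<in>V. u v * r v)"
      by (simp add: algebra_simps sum.distrib sum_distrib_left)
    then have "(\<Sum>v\<in>V. u v * (g v + t * r v)) = 0" using g1 r_orth by simp
    from le[OF this] have "0 \<le> 2 * t * (m * I - B) + t\<^sup>2 * c"
      unfolding Nt Qt c_def by (simp add: algebra_simps)
    then show ?thesis by (simp add: NB)
  qed
  have "N r = 0"
  proof (rule ccontr)
    assume "N r \<noteq> 0"
    then have pos: "N r > 0" using N0[of r] by simp
    \<comment> \<open>small enough for the linear term to dominate; adding 1 covers the case \<open>c = 0\<close>\<close>
    define t where "t = N r / (c + 1)"
    have t: "t > 0" using pos c0 by (simp add: t_def)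
    have "t * (2 * N r) \<le> t * (t * c)" using quad[of "- t"] by (simp add: power2_eq_square)
    then have "2 * N r \<le> t * c" using t by simp
    also have "t * c \<le> N r" using pos c0 by (simp add: t_def field_simps)
    finally show False using pos by simp
  qed
  then have "(\<Sum>w\<in>V. a v w * g w) = m * g v" if "v \<in> V" for v
    using that unfolding N0iff by (simp add: r_def)
  moreover have "\<exists>v\<in>V. g v \<noteq> 0" using g1(1) N0iff[of g] by auto
  ultimately show thesis using that[of m g] \<open>m > \<theta>\<close> g1(2) by blast
qed

text \<open>
  A function violating the bound would produce a second eigenfunction, orthogonal to \<open>u\<close>, and hence
  two eigenvalues above \<open>\<theta>\<close>.
\<close>

lemma quadratic_form_le_second_eigenvalue:
  fixes u f :: "'a \<Rightarrow> real"
  assumes "finite V"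
    and u: "\<And>v. v \<in> V \<Longrightarrow> (\<Sum>w\<in>V. adj E v w * u w) = l * u v" "\<exists>v\<in>V. u v \<noteq> 0"
    and eig: "graph_eigenvalue V E 2 \<le> \<theta>" "\<theta> < l"
    and f: "(\<Sum>v\<in>V. u v * f v) = 0"
  shows "(\<Sum>v\<in>V. \<Sum>w\<in>V. adj E v w * f v * f w) \<le> \<theta> * (\<Sum>v\<in>V. (f v)\<^sup>2)"
proof (rule ccontr)
  assume "\<not> ?thesis"
  then have large: "(\<Sum>v\<in>V. \<Sum>w\<in>V. adj E v w * f v * f w) > \<theta> * (\<Sum>v\<in>V. (f v)\<^sup>2)" by simp
  show False
  proof (rule eigenfunction_from_large_quadratic_form[where a = "adj E" and V = V and u = u and h = f
        and l = l and \<theta> = \<theta>, OF assms(1) adj_sym u(1) f large])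
    fix g m
    assume g: "m > \<theta>" "\<And>v. v \<in> V \<Longrightarrow> (\<Sum>w\<in>V. adj E v w * g w) = m * g v"
      "\<exists>v\<in>V. g v \<noteq> 0" "(\<Sum>v\<in>V. u v * g v) = 0"
    have "graph_eigenvalue V E 2 > \<theta>"
      by (rule second_eigenvalue_gt[OF assms(1) u eig(2) g(2,3,1,4)])
    with eig(1) show False by simp
  qed
qed

section \<open>Degrees and edge boundaries\<close>

lemma sum_adj_eq_degree:
  assumes "simple_graph V E" "v \<in> V"
  shows "(\<Sum>w\<in>V. adj E v w) = real (degree_in E v)"
proof -
  have V: "finite V" and E: "\<And>e. e \<in> E \<Longrightarrow> e \<subseteq> V \<and> card e = 2"
    using assms(1) by (auto simp: simple_graph_def)
  have "{e \<in> E. v \<in> e} = (\<lambda>w. {v, w}) ` {w \<in> V. {v, w} \<in> E}"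
  proof (intro equalityI subsetI)
    fix e assume e: "e \<in> {e \<in> E. v \<in> e}"
    then obtain p q where "e = {p, q}" using E[of e] by (auto simp: card_2_iff)
    then obtain w where "e = {v, w}" using e by auto
    then show "e \<in> (\<lambda>w. {v, w}) ` {w \<in> V. {v, w} \<in> E}" using e E[of e] by auto
  qed auto
  moreover have "inj_on (\<lambda>w. {v, w}) {w \<in> V. {v, w} \<in> E}"
    by (auto simp: inj_on_def doubleton_eq_iff)
  ultimately have "degree_in E v = card {w \<in> V. {v, w} \<in> E}"
    by (simp add: degree_in_def card_image)
  moreover have "(\<Sum>w\<in>V. adj E v w) = real (card {w \<in> V. {v, w} \<in> E})"
    using V by (simp add: adj_def sum.If_cases Int_def)
  ultimately show ?thesis by simp
qed

lemma sum_degree_eq: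
  assumes "simple_graph V E"
  shows "(\<Sum>v\<in>V. degree_in E v) = 2 * card E"
proof -
  have V: "finite V" and E: "\<And>e. e \<in> E \<Longrightarrow> e \<subseteq> V \<and> card e = 2"
    using assms by (auto simp: simple_graph_def)
  have fE: "finite E" by (rule finite_subset[of _ "Pow V"]) (use E V in auto)
  have "(\<Sum>v\<in>V. degree_in E v) = (\<Sum>v\<in>V. \<Sum>e\<in>E. if v \<in> e then 1 else 0)"
    using fE by (simp add: degree_in_def sum.If_cases Int_def)
  also have "\<dots> = (\<Sum>e\<in>E. \<Sum>v\<in>V. if v \<in> e then 1 else 0)" by (rule sum.swap)
  also have "\<dots> = (\<Sum>e\<in>E. 2)"
  proof (rule sum.cong)
    fix e assume e: "e \<in> E"
    then have "{v \<in> V. v \<in> e} = e" using E by blast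
    then show "(\<Sum>v\<in>V. if v \<in> e then 1 else 0) = (2::nat)"
      using E[OF e] V by (simp add: sum.If_cases Int_def)
  qed simp
  finally show ?thesis by simp
qed

definition boundary :: "'a set \<Rightarrow> 'a set set \<Rightarrow> 'a set \<Rightarrow> real" where
  "boundary V E C = (\<Sum>v\<in>C. \<Sum>w\<in>V - C. adj E v w)"

lemma sum_over_partition:
  assumes "finite V" "\<Union>P = V" "\<And>C C'. C \<in> P \<Longrightarrow> C' \<in> P \<Longrightarrow> C \<noteq> C' \<Longrightarrow> C \<inter> C' = {}"
  shows "(\<Sum>C\<in>P. sum h C) = sum h V"
proof -
  have "\<forall>C\<in>P. finite C" using assms(1,2) by (metis Union_upper finite_subset)
  moreover have "\<forall>C\<in>P. \<forall>C'\<in>P. C \<noteq> C' \<longrightarrow> C \<inter> C' = {}" by (simp add: assms(3))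
  ultimately have "sum h (\<Union>P) = (\<Sum>C\<in>P. sum h C)" by (simp add: sum.Union_disjoint)
  then show ?thesis by (simp add: assms(2))
qed

text \<open>
  In the graph of the crossing edges, the sum on the left is at most the sum of all degrees, which is
  twice the number of edges.
\<close>

lemma sum_boundary_le:
  assumes G: "simple_graph V E"
    and P: "\<Union>P = V" "\<And>C C'. C \<in> P \<Longrightarrow> C' \<in> P \<Longrightarrow> C \<noteq> C' \<Longrightarrow> C \<inter> C' = {}"
  shows "(\<Sum>C\<in>P. boundary V E C) \<le> 2 * real (card {e \<in> E. \<not> (\<exists>C\<in>P. e \<subseteq> C)})"
proof -
  let ?X = "{e \<in> E. \<not> (\<exists>C\<in>P. e \<subseteq> C)}"
  have V: "finite V" and X: "simple_graph V ?X" using G by (auto simp: simple_graph_def)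
  have "boundary V E C \<le> (\<Sum>v\<in>C. \<Sum>w\<in>V. adj ?X v w)" if C: "C \<in> P" for C
    unfolding boundary_def
  proof (rule sum_mono)
    fix v assume v: "v \<in> C"
    have "(\<Sum>w\<in>V - C. adj E v w) = (\<Sum>w\<in>V - C. adj ?X v w)"
    proof (rule sum.cong)
      fix w assume w: "w \<in> V - C"
      have "\<not> (\<exists>C'\<in>P. {v, w} \<subseteq> C')" using P(2)[OF C] v w by blast
      then show "adj E v w = adj ?X v w" by (simp add: adj_def)
    qed simp
    also have "\<dots> \<le> (\<Sum>w\<in>V. adj ?X v w)"
      by (rule sum_mono2) (use V in \<open>auto simp: adj_def\<close>)
    finally show "(\<Sum>w\<in>V - C. adj E v w) \<le> (\<Sum>w\<in>V. adj ?X v w)" .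
  qed
  then have "(\<Sum>C\<in>P. boundary V E C) \<le> (\<Sum>C\<in>P. \<Sum>v\<in>C. \<Sum>w\<in>V. adj ?X v w)"
    by (rule sum_mono)
  also have "\<dots> = (\<Sum>v\<in>V. \<Sum>w\<in>V. adj ?X v w)"
    by (rule sum_over_partition[OF V P])
  also have "\<dots> = (\<Sum>v\<in>V. real (degree_in ?X v))"
    by (rule sum.cong) (use sum_adj_eq_degree[OF X] in auto)
  also have "\<dots> = 2 * real (card ?X)"
    by (simp only: of_nat_sum[symmetric] sum_degree_eq[OF X] of_nat_mult of_nat_numeral)
  finally show ?thesis .
qed

text \<open>
  Substituting \<open>f = u g\<close> with an eigenfunction \<open>u\<close> turns \<open>l |f|\<^sup>2\<close> minus the quadratic form into a
  weighted sum of squared differences of \<open>g\<close> along the edges. For an indicator function \<open>g\<close> only the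
  edges leaving a set contribute.
\<close>

lemma eigenfunction_dirichlet_identity:
  fixes u g :: "'a \<Rightarrow> real"
  assumes u: "\<And>v. v \<in> V \<Longrightarrow> (\<Sum>w\<in>V. adj E v w * u w) = l * u v"
  shows "(\<Sum>v\<in>V. \<Sum>w\<in>V. adj E v w * (u v * u w) * (g v - g w)\<^sup>2)
       = 2 * (l * (\<Sum>v\<in>V. (u v * g v)\<^sup>2) - (\<Sum>v\<in>V. \<Sum>w\<in>V. adj E v w * (u v * g v) * (u w * g w)))"
proof -
  have 1: "(\<Sum>v\<in>V. \<Sum>w\<in>V. adj E v w * (u v * u w) * (g v)\<^sup>2) = l * (\<Sum>v\<in>V. (u v * g v)\<^sup>2)"
    unfolding sum_distrib_left
  proof (rule sum.cong)
    fix v assume v: "v \<in> V"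
    have "(\<Sum>w\<in>V. adj E v w * (u v * u w) * (g v)\<^sup>2) = u v * (g v)\<^sup>2 * (\<Sum>w\<in>V. adj E v w * u w)"
      by (simp add: sum_distrib_left mult_ac)
    also have "\<dots> = l * (u v * g v)\<^sup>2" by (simp add: u[OF v] power2_eq_square)
    finally show "(\<Sum>w\<in>V. adj E v w * (u v * u w) * (g v)\<^sup>2) = l * (u v * g v)\<^sup>2" .
  qed simp
  have 2: "(\<Sum>v\<in>V. \<Sum>w\<in>V. adj E v w * (u v * u w) * (g w)\<^sup>2)
           = (\<Sum>v\<in>V. \<Sum>w\<in>V. adj E v w * (u v * u w) * (g v)\<^sup>2)"
    by (subst sum.swap) (simp add: adj_sym mult_ac)
  have "(\<Sum>v\<in>V. \<Sum>w\<in>V. adj E v w * (u v * u w) * (g v - g w)\<^sup>2)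
      = (\<Sum>v\<in>V. \<Sum>w\<in>V. adj E v w * (u v * u w) * (g v)\<^sup>2)
        + (\<Sum>v\<in>V. \<Sum>w\<in>V. adj E v w * (u v * u w) * (g w)\<^sup>2)
        - 2 * (\<Sum>v\<in>V. \<Sum>w\<in>V. adj E v w * (u v * g v) * (u w * g w))"
    unfolding sum_distrib_left sum.distrib[symmetric] sum_subtractf[symmetric]
    by (intro sum.cong refl) (simp_all add: power2_eq_square algebra_simps)
  then show ?thesis unfolding 2 1 by simp
qed

section \<open>Cuts in biregular graphs\<close>

lemma biregular_simple: "biregular_graph V E X Y a b \<Longrightarrow> simple_graph V E"
  by (simp add: biregular_graph_def)

lemma biregular_adj_sides:
  assumes "biregular_graph V E X Y a b" "adj E v w \<noteq> 0"
  shows "(v \<in> X \<and> w \<in> Y) \<or> (v \<in> Y \<and> w \<in> X)"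
proof -
  have "{v, w} \<in> E" using assms(2) by (simp add: adj_def split: if_splits)
  moreover have "\<forall>e\<in>E. \<exists>x\<in>X. \<exists>y\<in>Y. e = {x, y}"
    using assms(1) by (simp add: biregular_graph_def)
  ultimately obtain x y where "x \<in> X" "y \<in> Y" "{v, w} = {x, y}" by blast
  then show ?thesis by (auto simp: doubleton_eq_iff)
qed

lemma biregular_sum_adj:
  assumes G: "biregular_graph V E X Y a b" and v: "v \<in> V"
  shows "(\<Sum>w\<in>V. adj E v w) = real (if v \<in> X then a else b)"
  using sum_adj_eq_degree[OF biregular_simple[OF G] v] G v
  by (auto simp: biregular_graph_def)

text \<open>
  The Perron eigenfunction; \<open>(perron X a b v)\<^sup>2\<close> is the degree of \<open>v\<close>.
\<close>

definition perron :: "'a set \<Rightarrow> nat \<Rightarrow> nat \<Rightarrow> 'a \<Rightarrow> real" where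
  "perron X a b v = sqrt (real (if v \<in> X then a else b))"

lemma perron_eigenfunction:
  assumes G: "biregular_graph V E X Y a b" and v: "v \<in> V"
  shows "(\<Sum>w\<in>V. adj E v w * perron X a b w) = sqrt (real a * real b) * perron X a b v"
proof -
  have disj: "X \<inter> Y = {}" using G by (simp add: biregular_graph_def)
  have "(\<Sum>w\<in>V. adj E v w * perron X a b w)
      = (\<Sum>w\<in>V. adj E v w * sqrt (real (if v \<in> X then b else a)))"
  proof (rule sum.cong)
    fix w
    show "adj E v w * perron X a b w = adj E v w * sqrt (real (if v \<in> X then b else a))"
      using biregular_adj_sides[OF G, of v w] disj by (cases "adj E v w = 0") (auto simp: perron_def)
  qed simp
  also have "\<dots> = real (if v \<in> X then a else b) * sqrt (real (if v \<in> X then b else a))"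
    using biregular_sum_adj[OF G v] by (simp add: sum_distrib_right[symmetric])
  also have "\<dots> = sqrt (real a * real b) * perron X a b v"
    by (auto simp: perron_def real_sqrt_mult)
  finally show ?thesis .
qed

definition vol :: "'a set \<Rightarrow> nat \<Rightarrow> nat \<Rightarrow> 'a set \<Rightarrow> real" where
  "vol X a b C = (\<Sum>v\<in>C. (perron X a b v)\<^sup>2)"

text \<open>
  The test function is \<open>u\<close> times the indicator function of \<open>C\<close>, shifted by the constant
  \<open>vol C / vol V\<close>, which makes it orthogonal to \<open>u\<close>. The shift does not affect differences along edges,
  and its squared norm is \<open>vol C (1 - vol C / vol V)\<close>.
\<close>

lemma spectral_cut_bound:
  assumes G: "biregular_graph V E X Y a b" and C: "C \<subseteq> V"
    and eig: "graph_eigenvalue V E 2 \<le> \<theta>" "\<theta> < sqrt (real a * real b)"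
  shows "(sqrt (real a * real b) - \<theta>) * (vol X a b C * (1 - vol X a b C / vol X a b V))
           \<le> sqrt (real a * real b) * boundary V E C"
proof -
  let ?l = "sqrt (real a * real b)" and ?u = "perron X a b"
  have V: "finite V" "V \<noteq> {}" and disj: "X \<inter> Y = {}" and ab: "a > 0" "b > 0"
    using G by (auto simp: biregular_graph_def simple_graph_def)
  have upos: "?u v > 0" for v using ab by (simp add: perron_def)
  define W where "W = vol X a b V"
  define c where "c = vol X a b C / W"
  define i where "i v = (if v \<in> C then 1 else 0 :: real)" for v
  define g where "g v = i v - c" for v
  have "(?u v)\<^sup>2 > 0" for v using upos[of v] by simp
  then have W: "W > 0" unfolding W_def vol_def using V by (intro sum_pos) auto
  have vC: "vol X a b C = (\<Sum>v\<in>V. (?u v)\<^sup>2 * i v)"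
    unfolding vol_def i_def using C V by (simp add: sum.If_cases Int_absorb1 if_distrib cong: if_cong)
  have cW: "c * W = vol X a b C" using W by (simp add: c_def)
  have "(\<Sum>v\<in>V. ?u v * (?u v * g v)) = (\<Sum>v\<in>V. (?u v)\<^sup>2 * i v) - c * (\<Sum>v\<in>V. (?u v)\<^sup>2)"
    unfolding sum_distrib_left sum_subtractf[symmetric]
    by (rule sum.cong) (auto simp: g_def power2_eq_square algebra_simps)
  also have "\<dots> = 0" using cW by (simp add: vC[symmetric] W_def vol_def)
  finally have orth: "(\<Sum>v\<in>V. ?u v * (?u v * g v)) = 0" .
  have nz: "\<exists>v\<in>V. ?u v \<noteq> 0" using V(2) upos by (metis all_not_in_conv less_irrefl)
  have norm: "(\<Sum>v\<in>V. (?u v * g v)\<^sup>2) = vol X a b C * (1 - c)"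
  proof -
    have "(\<Sum>v\<in>V. (?u v * g v)\<^sup>2)
        = (1 - 2 * c) * (\<Sum>v\<in>V. (?u v)\<^sup>2 * i v) + c\<^sup>2 * (\<Sum>v\<in>V. (?u v)\<^sup>2)"
      unfolding sum_distrib_left sum.distrib[symmetric]
      by (rule sum.cong) (auto simp: g_def i_def power2_eq_square algebra_simps)
    also have "\<dots> = (1 - 2 * c) * vol X a b C + c * (c * W)"
      unfolding vC[symmetric] W_def vol_def[of X a b V] by (simp add: power2_eq_square)
    also have "\<dots> = vol X a b C * (1 - c)" unfolding cW by (simp add: algebra_simps)
    finally show ?thesis .
  qed
  \<comment> \<open>along an edge the product of the two values of \<open>u\<close> is \<open>sqrt (a b)\<close>\<close>
  have "(\<Sum>v\<in>V. \<Sum>w\<in>V. adj E v w * (?u v * ?u w) * (g v - g w)\<^sup>2)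
      = (\<Sum>v\<in>V. \<Sum>w\<in>V. ?l * (adj E v w * (i v * (1 - i w)) + adj E w v * (i w * (1 - i v))))"
  proof (intro sum.cong refl)
    fix v w
    show "adj E v w * (?u v * ?u w) * (g v - g w)\<^sup>2
        = ?l * (adj E v w * (i v * (1 - i w)) + adj E w v * (i w * (1 - i v)))"
    proof (cases "adj E v w = 0")
      case False
      then have "?u v * ?u w = ?l"
        using biregular_adj_sides[OF G False] disj
        by (auto simp: perron_def real_sqrt_mult mult.commute)
      then show ?thesis by (simp add: adj_sym[of E w v] g_def i_def)
    qed (simp add: adj_sym[of E w v])
  qed simp_all
  also have "\<dots> = ?l * ((\<Sum>v\<in>V. \<Sum>w\<in>V. adj E v w * (i v * (1 - i w)))
                     + (\<Sum>v\<in>V. \<Sum>w\<in>V. adj E w v * (i w * (1 - i v))))"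
    by (simp add: sum_distrib_left sum.distrib distrib_left)
  also have "(\<Sum>v\<in>V. \<Sum>w\<in>V. adj E w v * (i w * (1 - i v)))
           = (\<Sum>v\<in>V. \<Sum>w\<in>V. adj E v w * (i v * (1 - i w)))"
    by (rule sum.swap)
  also have "(\<Sum>v\<in>V. \<Sum>w\<in>V. adj E v w * (i v * (1 - i w))) = boundary V E C"
  proof -
    have inner: "(\<Sum>w\<in>V. adj E v w * (i v * (1 - i w))) = (if v \<in> C then \<Sum>w\<in>V - C. adj E v w else 0)" for v
    proof (cases "v \<in> C")
      case True
      then have "(\<Sum>w\<in>V. adj E v w * (i v * (1 - i w))) = (\<Sum>w\<in>V. if w \<in> C then 0 else adj E v w)"
        by (intro sum.cong) (auto simp: i_def)
      also have "\<dots> = (\<Sum>w\<in>V - C. adj E v w)"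
        using V(1) by (simp add: sum.If_cases Diff_eq)
      finally show ?thesis using True by simp
    qed (simp add: i_def)
    show ?thesis unfolding inner boundary_def
      using V(1) C by (simp add: sum.If_cases Int_absorb1)
  qed
  finally have "?l * (\<Sum>v\<in>V. (?u v * g v)\<^sup>2)
      - (\<Sum>v\<in>V. \<Sum>w\<in>V. adj E v w * (?u v * g v) * (?u w * g w)) = ?l * boundary V E C"
    using eigenfunction_dirichlet_identity[where g = g and u = ?u and l = ?l, OF perron_eigenfunction[OF G]]
    by simp
  moreover have "(\<Sum>v\<in>V. \<Sum>w\<in>V. adj E v w * (?u v * g v) * (?u w * g w))
      \<le> \<theta> * (\<Sum>v\<in>V. (?u v * g v)\<^sup>2)"
    by (rule quadratic_form_le_second_eigenvalue[OF V(1) perron_eigenfunction[OF G] nz eig orth])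
  ultimately show ?thesis
    unfolding norm by (simp add: c_def W_def left_diff_distrib)
qed

text \<open>
  A vertex of \<open>C \<inter> X\<close> has at most \<open>card (C \<inter> Y)\<close> of its \<open>a\<close> neighbours inside \<open>C\<close>.
\<close>

lemma boundary_ge:
  assumes G: "biregular_graph V E X Y a b" and C: "C \<subseteq> V"
  shows "boundary V E C \<ge> real (card (C \<inter> X)) * (real a - real (card (C \<inter> Y)))
           + real (card (C \<inter> Y)) * (real b - real (card (C \<inter> X)))"
proof -
  have V: "finite V" "X \<inter> Y = {}" "X \<union> Y = V"
    using G by (auto simp: biregular_graph_def simple_graph_def)
  have fC: "finite C" using C V(1) by (rule finite_subset)
  have outside: "(\<Sum>w\<in>V - C. adj E v w) \<ge> real d - real (card S)"
    if "v \<in> C" "(\<Sum>w\<in>V. adj E v w) = real d" "\<And>w. w \<in> C \<Longrightarrow> adj E v w \<noteq> 0 \<Longrightarrow> w \<in> S" "S \<subseteq> C"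
    for v d S
  proof -
    have "(\<Sum>w\<in>C. adj E v w) \<le> (\<Sum>w\<in>C. if w \<in> S then 1 else 0)"
      by (rule sum_mono) (use that(3) in \<open>auto simp: adj_def\<close>)
    also have "\<dots> = real (card S)" using fC that(4) by (simp add: sum.If_cases Int_absorb1)
    finally show ?thesis using that(2) sum.subset_diff[OF C V(1), of "adj E v"] by simp
  qed
  have "real (card (C \<inter> X)) * (real a - real (card (C \<inter> Y)))
      \<le> (\<Sum>v\<in>C \<inter> X. \<Sum>w\<in>V - C. adj E v w)"
  proof (rule sum_bounded_below)
    fix v assume v: "v \<in> C \<inter> X"
    show "real a - real (card (C \<inter> Y)) \<le> (\<Sum>w\<in>V - C. adj E v w)"
      by (rule outside)
        (use v V biregular_adj_sides[OF G, of v] biregular_sum_adj[OF G, of v] in auto)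
  qed
  moreover have "real (card (C \<inter> Y)) * (real b - real (card (C \<inter> X)))
      \<le> (\<Sum>v\<in>C \<inter> Y. \<Sum>w\<in>V - C. adj E v w)"
  proof (rule sum_bounded_below)
    fix v assume v: "v \<in> C \<inter> Y"
    show "real b - real (card (C \<inter> X)) \<le> (\<Sum>w\<in>V - C. adj E v w)"
      by (rule outside)
        (use v V biregular_adj_sides[OF G, of v] biregular_sum_adj[OF G, of v] in auto)
  qed
  moreover have "boundary V E C = (\<Sum>v\<in>C \<inter> X. \<Sum>w\<in>V - C. adj E v w) + (\<Sum>v\<in>C \<inter> Y. \<Sum>w\<in>V - C. adj E v w)"
  proof -
    have "C = (C \<inter> X) \<union> (C \<inter> Y)" using C V by blast
    then show ?thesis unfolding boundary_def
      using V fC by (subst sum.union_disjoint[symmetric]) auto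
  qed
  ultimately show ?thesis by simp
qed

text \<open>
  Here \<open>p\<close> and \<open>q\<close> are the numbers of vertices of a set on the two sides. Rewritten as
  \<open>p (a - 2 q) + q b\<close>, the left-hand side is at least \<open>p a\<close> for \<open>q = 0\<close> and at least \<open>b\<close> for \<open>0 < q \<le> a / 2\<close>.
\<close>

lemma half_degree_less_of_small_cut:
  fixes a b p q k :: nat
  assumes "a \<ge> 2 * k" "b \<ge> 2 * k" "k \<ge> 1" "p + q > 0"
    and cut: "real p * (real a - real q) + real q * (real b - real p) < 2 * real k"
  shows "a < 2 * q"
proof (rule ccontr)
  assume "\<not> a < 2 * q"
  then have aq: "real a - 2 * real q \<ge> 0" by simp
  have e: "real p * (real a - real q) + real q * (real b - real p)
      = real p * (real a - 2 * real q) + real q * real b" by (simp add: algebra_simps)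
  show False
  proof (cases "q = 0")
    case True
    then have "real p * real a \<ge> 1 * (2 * real k)"
      using assms by (intro mult_mono) auto
    then show False using cut True by simp
  next
    case False
    then have "real q * real b \<ge> 1 * (2 * real k)"
      using assms by (intro mult_mono) auto
    moreover have "real p * (real a - 2 * real q) \<ge> 0" using aq by simp
    ultimately show False using cut unfolding e by linarith
  qed
qed

text \<open>
  If fewer than \<open>2 k\<close> edges leave \<open>C\<close>, then \<open>C\<close> has \<open>p \<ge> \<lceil>(b + 1) / 2\<rceil>\<close> vertices in \<open>X\<close> and
  \<open>q \<ge> \<lceil>(a + 1) / 2\<rceil>\<close> in \<open>Y\<close>. The inequality of arithmetic and geometric means gives
  \<open>vol C = p a + q b \<ge> 2 sqrt (a b) sqrt (p q)\<close>, and this cancels both \<open>sqrt (a b)\<close> and the square root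
  in the spectral gap from the cut bound.
\<close>

lemma boundary_ge_of_second_eigenvalue:
  assumes G: "biregular_graph V E X Y a b" and k: "k \<ge> 1" "a \<ge> 2 * k" "b \<ge> 2 * k"
    and eig: "graph_eigenvalue V E 2 \<le>
           sqrt (real a * real b)
           - real k / sqrt (real_of_int (\<lceil>(real a + 1) / 2\<rceil> * \<lceil>(real b + 1) / 2\<rceil>))"
    and C: "C \<subseteq> V" "C \<noteq> {}"
  shows "boundary V E C \<ge> 2 * real k * (1 - vol X a b C / vol X a b V)"
proof -
  let ?A = "\<lceil>(real a + 1) / 2\<rceil>" and ?B = "\<lceil>(real b + 1) / 2\<rceil>" and ?l = "sqrt (real a * real b)"
  have V: "finite V" "V \<noteq> {}" "X \<inter> Y = {}" "X \<union> Y = V" and ab: "a > 0" "b > 0"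
    using G by (auto simp: biregular_graph_def simple_graph_def)
  have fC: "finite C" using C V(1) finite_subset by blast
  define p q where "p = card (C \<inter> X)" and "q = card (C \<inter> Y)"
  have upos: "(perron X a b v)\<^sup>2 > 0" for v using ab by (simp add: perron_def)
  have vC: "vol X a b C > 0" unfolding vol_def by (rule sum_pos) (use fC C upos in auto)
  have vV: "vol X a b V > 0" unfolding vol_def by (rule sum_pos) (use V upos in auto)
  show ?thesis
  proof (cases "boundary V E C < 2 * real k")
    case False
    have "2 * real k * (1 - vol X a b C / vol X a b V) \<le> 2 * real k * 1"
      using vC vV by (intro mult_left_mono) auto
    then show ?thesis using False by simp
  next
    case True
    have "C = (C \<inter> X) \<union> (C \<inter> Y)" using C V by blast
    then have pq: "p + q > 0" using C(2) fC unfolding p_def q_def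
      by (metis add_gr_0 card_gt_0_iff finite_Int sup_bot.right_neutral)
    have cut: "real p * (real a - real q) + real q * (real b - real p) < 2 * real k"
      using boundary_ge[OF G C(1)] True unfolding p_def q_def by linarith
    have "a < 2 * q" using half_degree_less_of_small_cut[OF k(2,3,1) pq cut] .
    then have Aq: "?A \<le> int q" by (simp add: ceiling_le_iff)
    have "q + p > 0"
      and "real q * (real b - real p) + real p * (real a - real q) < 2 * real k"
      using pq cut by (simp_all add: add.commute)
    then have "b < 2 * p" by (rule half_degree_less_of_small_cut[OF k(3,2,1)])
    then have Bp: "?B \<le> int p" by (simp add: ceiling_le_iff)
    have AB: "?A > 0" "?B > 0" using ab by simp_all
    define s where "s = sqrt (real_of_int (?A * ?B))"
    have s: "s > 0" unfolding s_def using AB by simp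
    have "?A * ?B \<le> int q * int p" using Aq Bp AB by (intro mult_mono) auto
    then have "real_of_int (?A * ?B) \<le> real q * real p"
      by (metis of_int_le_iff of_int_mult of_int_of_nat_eq)
    then have s_le: "s \<le> sqrt (real q * real p)" unfolding s_def by (rule real_sqrt_le_mono)
    have "vol X a b C = (\<Sum>v\<in>C \<inter> X. (perron X a b v)\<^sup>2) + (\<Sum>v\<in>C \<inter> Y. (perron X a b v)\<^sup>2)"
      unfolding vol_def using V fC \<open>C = (C \<inter> X) \<union> (C \<inter> Y)\<close>
      by (subst sum.union_disjoint[symmetric]) auto
    also have "(\<Sum>v\<in>C \<inter> X. (perron X a b v)\<^sup>2) = (\<Sum>v\<in>C \<inter> X. real a)"
      by (rule sum.cong) (auto simp: perron_def)
    also have "(\<Sum>v\<in>C \<inter> Y. (perron X a b v)\<^sup>2) = (\<Sum>v\<in>C \<inter> Y. real b)"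
      by (rule sum.cong) (use V in \<open>auto simp: perron_def\<close>)
    finally have vol: "vol X a b C = real p * real a + real q * real b"
      by (simp add: p_def q_def)
    have "2 * (?l * s) \<le> 2 * (?l * sqrt (real q * real p))" using s_le by (simp add: mult_left_mono)
    also have "\<dots> = 2 * sqrt ((real p * real a) * (real q * real b))"
      by (simp add: real_sqrt_mult mult_ac)
    also have "\<dots> \<le> vol X a b C"
      using arith_geo_mean_sqrt[of "real p * real a" "real q * real b"] unfolding vol by simp
    finally have vol_ge: "2 * (?l * s) \<le> vol X a b C" .
    have "(?l - (?l - real k / s)) * (vol X a b C * (1 - vol X a b C / vol X a b V)) \<le> ?l * boundary V E C"
      by (rule spectral_cut_bound[OF G C(1)]) (use eig s k in \<open>simp_all add: s_def\<close>)
    then have main: "real k * (vol X a b C * (1 - vol X a b C / vol X a b V)) \<le> (?l * s) * boundary V E C"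
      using s by (simp add: field_simps)
    have b0: "boundary V E C \<ge> 0" unfolding boundary_def by (intro sum_nonneg) (simp add: adj_def)
    have "vol X a b C * (2 * real k * (1 - vol X a b C / vol X a b V))
        = 2 * (real k * (vol X a b C * (1 - vol X a b C / vol X a b V)))"
      by (simp only: mult_ac)
    also have "\<dots> \<le> 2 * ((?l * s) * boundary V E C)" using main by (simp only: mult_left_mono)
    also have "\<dots> = 2 * (?l * s) * boundary V E C" by (simp only: mult.assoc)
    also have "\<dots> \<le> vol X a b C * boundary V E C"
      by (rule mult_right_mono[OF vol_ge b0])
    finally show ?thesis using vC by simp
  qed
qed

text \<open>
  Summation of the preceding bound over the classes: the volume fractions add up to 1, and each
  crossing edge leaves two classes.
\<close>

lemma partition_crossing_edges_ge:
  assumes G: "biregular_graph V E X Y a b" and k: "k \<ge> 1" "a \<ge> 2 * k" "b \<ge> 2 * k"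
    and eig: "graph_eigenvalue V E 2 \<le>
           sqrt (real a * real b)
           - real k / sqrt (real_of_int (\<lceil>(real a + 1) / 2\<rceil> * \<lceil>(real b + 1) / 2\<rceil>))"
    and P: "\<Union>P = V" "\<And>C C'. C \<in> P \<Longrightarrow> C' \<in> P \<Longrightarrow> C \<noteq> C' \<Longrightarrow> C \<inter> C' = {}" "{} \<notin> P"
  shows "k * (card P - 1) \<le> card {e \<in> E. \<not> (\<exists>C\<in>P. e \<subseteq> C)}"
proof -
  have V: "finite V" "V \<noteq> {}" and ab: "a > 0" "b > 0"
    using G by (auto simp: biregular_graph_def simple_graph_def)
  have fP: "finite P" using P(1) V(1) finite_UnionD by blast
  have "P \<noteq> {}" using P(1) V(2) by blast
  then have cP: "card P \<ge> 1" using fP by (simp add: Suc_leI card_gt_0_iff)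
  have vV: "vol X a b V > 0" unfolding vol_def
    by (rule sum_pos) (use V ab in \<open>auto simp: perron_def\<close>)
  have "(\<Sum>C\<in>P. vol X a b C) = vol X a b V"
    unfolding vol_def by (rule sum_over_partition[OF V(1) P(1,2)])
  then have "(\<Sum>C\<in>P. vol X a b C / vol X a b V) = 1"
    using vV by (simp add: sum_divide_distrib[symmetric])
  then have "2 * real k * (real (card P) - 1) = (\<Sum>C\<in>P. 2 * real k * (1 - vol X a b C / vol X a b V))"
    by (simp add: sum_distrib_left[symmetric] sum_subtractf)
  also have "\<dots> \<le> (\<Sum>C\<in>P. boundary V E C)"
  proof (rule sum_mono)
    fix C assume C: "C \<in> P"
    have "C \<subseteq> V" unfolding P(1)[symmetric] using C by (rule Union_upper)
    moreover have "C \<noteq> {}" using C P(3) by metis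
    ultimately show "2 * real k * (1 - vol X a b C / vol X a b V) \<le> boundary V E C"
      by (rule boundary_ge_of_second_eigenvalue[OF G k eig])
  qed
  also have "\<dots> \<le> 2 * real (card {e \<in> E. \<not> (\<exists>C\<in>P. e \<subseteq> C)})"
    by (rule sum_boundary_le[OF biregular_simple[OF G] P(1,2)])
  finally have "real k * (real (card P) - 1) \<le> real (card {e \<in> E. \<not> (\<exists>C\<in>P. e \<subseteq> C)})" by simp
  then have "real (k * (card P - 1)) \<le> real (card {e \<in> E. \<not> (\<exists>C\<in>P. e \<subseteq> C)})"
    using cP by (simp add: of_nat_diff)
  then show ?thesis by (simp only: of_nat_le_iff)
qed

section \<open>Packing spanning trees in biregular graphs\<close>

lemma link_classes_partition:
  assumes D: "\<And>e. e \<in> D \<Longrightarrow> e \<subseteq> V"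
  shows "\<Union>(link_classes V D) = V" and "{} \<notin> link_classes V D"
    and "\<And>C C'. C \<in> link_classes V D \<Longrightarrow> C' \<in> link_classes V D \<Longrightarrow> C \<noteq> C' \<Longrightarrow> C \<inter> C' = {}"
proof -
  have closed: "w \<in> V" if vw: "(v, w) \<in> linked D" and v: "v \<in> V" for v w
  proof -
    from vw have "(v, w) \<in> {(x, y). {x, y} \<in> D}\<^sup>*" by (simp only: linked_def)
    then show "w \<in> V"
    proof (induction rule: rtrancl_induct)
      case base
      show ?case by (rule v)
    next
      case (step y z)
      have "{y, z} \<subseteq> V" by (rule D) (use step.hyps(2) in simp)
      then show ?case by blast
    qed
  qed
  show "\<Union>(link_classes V D) = V"
  proof (intro equalityI subsetI)
    fix w assume "w \<in> \<Union>(link_classes V D)"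
    then obtain v where "v \<in> V" "(v, w) \<in> linked D" by (auto simp: link_classes_def)
    then show "w \<in> V" by (rule closed[rotated])
  next
    fix w assume "w \<in> V"
    then have "linked D `` {w} \<in> link_classes V D" by (simp add: link_classes_def)
    moreover have "w \<in> linked D `` {w}" by simp
    ultimately show "w \<in> \<Union>(link_classes V D)" by (rule UnionI)
  qed
  show "{} \<notin> link_classes V D"
  proof
    assume "{} \<in> link_classes V D"
    then obtain v where "linked D `` {v} = {}" by (auto simp: link_classes_def)
    moreover have "v \<in> linked D `` {v}" by simp
    ultimately show False by simp
  qed
  fix C C' assume C: "C \<in> link_classes V D" "C' \<in> link_classes V D" "C \<noteq> C'"
  then obtain v v' where v: "C = linked D `` {v}" "C' = linked D `` {v'}"
    unfolding link_classes_def by blast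
  show "C \<inter> C' = {}"
  proof (rule ccontr)
    assume "C \<inter> C' \<noteq> {}"
    then obtain w where "(v, w) \<in> linked D" "(v', w) \<in> linked D" using v by blast
    then have "(v, v') \<in> linked D" by (rule linked_trans[OF _ linked_sym])
    then show False using C(3) v linked_class_eq[of D v v'] by simp
  qed
qed

lemma spanning_tree_packing_number_ge:
  assumes G: "simple_graph V E" and V: "x \<in> V" "y \<in> V" "x \<noteq> y"
    and F: "forest_packing E k F" "\<And>i. i < k \<Longrightarrow> graph_connected V (F i)"
  shows "spanning_tree_packing_number V E \<ge> k"
proof -
  have "E \<subseteq> Pow V" "finite V" using G by (auto simp: simple_graph_def)
  then have fE: "finite E" using finite_subset by blast
  have disj: "F i \<inter> F j = {}" if "i < k" "j < k" "i \<noteq> j" for i j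
    using F(1) that by (simp add: forest_packing_def disjoint_family_on_def)
  have ne: "F i \<noteq> {}" if "i < k" for i
  proof
    assume "F i = {}"
    then have "(x, y) \<in> {}\<^sup>*" using F(2)[OF that] V by (simp add: graph_connected_def)
    then show False using V(3) by simp
  qed
  have inj: "inj_on F {..<k}" using disj ne by (metis inf.idem inj_onI lessThan_iff)
  have tree: "F i \<in> spanning_trees V E" if "i < k" for i
  proof -
    have Fi: "F i \<subseteq> E" "forest (F i)" using F(1) that by (auto simp: forest_packing_def)
    then have "simple_graph V (F i)" using G unfolding simple_graph_def by blast
    then show ?thesis
      using Fi F(2)[OF that] forest_no_cycle[OF Fi(2)] by (simp add: spanning_trees_def is_tree_def)
  qed
  have "pairwise disjnt (F ` {..<k})"
    using disj by (auto simp: pairwise_def disjnt_def)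
  then have mem: "k \<in> {card F |F. F \<subseteq> spanning_trees V E \<and> pairwise disjnt F}"
    using tree card_image[OF inj] by (intro CollectI exI[of _ "F ` {..<k}"]) auto
  have "finite (spanning_trees V E)"
    by (rule finite_subset[of _ "Pow E"]) (use fE in \<open>auto simp: spanning_trees_def\<close>)
  then have "finite (card ` Pow (spanning_trees V E))" by simp
  then have "finite {card F |F. F \<subseteq> spanning_trees V E \<and> pairwise disjnt F}"
    by (rule rev_finite_subset) auto
  then show ?thesis unfolding spanning_tree_packing_number_def using mem by (rule Max_ge)
qed

theorem theorem2p3:
  fixes V X Y :: "'a set" and E :: "'a set set" and a b k :: nat
  assumes "k \<ge> 1"
    and "biregular_graph V E X Y a b"
    and "a \<ge> 2 * k" and "b \<ge> 2 * k"
    and "graph_eigenvalue V E 2 \<le>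
           sqrt (real a * real b)
           - real k / sqrt (real_of_int (\<lceil>(real a + 1) / 2\<rceil> * \<lceil>(real b + 1) / 2\<rceil>))"
  shows "spanning_tree_packing_number V E \<ge> k"
proof -
  note G = assms(2)
  have V: "finite V" "X \<noteq> {}" "Y \<noteq> {}" "X \<inter> Y = {}" "X \<union> Y = V"
    and sub: "\<And>e. e \<in> E \<Longrightarrow> e \<subseteq> V"
    using G by (auto simp: biregular_graph_def simple_graph_def)
  have "\<forall>e\<in>E. \<exists>x\<in>X. \<exists>y\<in>Y. e = {x, y}" using G by (simp add: biregular_graph_def)
  moreover have "X \<subseteq> V" "Y \<subseteq> V" using V(5) by auto
  ultimately have E: "\<exists>x\<in>V. \<exists>y\<in>V. e = {x, y}" if "e \<in> E" for e
    using that by (meson subsetD)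
  obtain x y where "x \<in> X" "y \<in> Y" using V(2,3) by blast
  then have xy: "x \<in> V" "y \<in> V" "x \<noteq> y" using V(4,5) by auto
  have "k * (card (link_classes V D) - 1) \<le> card {e \<in> E. \<not> (\<exists>C\<in>link_classes V D. e \<subseteq> C)}"
    if "D \<subseteq> E" for D
  proof -
    have D: "\<And>e. e \<in> D \<Longrightarrow> e \<subseteq> V" using sub that by blast
    show ?thesis
      by (rule partition_crossing_edges_ge[OF G assms(1,3,4,5) link_classes_partition(1,3,2)[OF D]])
  qed
  note cut = this
  have "V \<noteq> {}" using xy(1) by blast
  show ?thesis
  proof (rule nash_williams_tutte[OF V(1) \<open>V \<noteq> {}\<close> E cut])
    fix F assume "forest_packing E k F" "\<And>i. i < k \<Longrightarrow> graph_connected V (F i)"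
    then show ?thesis
      by (rule spanning_tree_packing_number_ge[OF biregular_simple[OF G] xy])
  qed
qed

end
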